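(* Let $S=\{S_t:t\ge0\}$ be a subordinator with Bernstein function $\phi$ given by $\phi(u)=bu+\int_{(0,\infty)}(1-\mathrm{e}^{-uy})\,\nu(\mathrm{d}y)$, $u>0$. a) Let $\theta>0$ and $\delta\in(0,1]$. If $\nu(\mathrm{d}y)\ge c\,y^{-1-\alpha}\,\mathrm{d}y$ for some constants $c>0$ and $\alpha\in(0,1)$, then there exists a $C=C(\theta,\delta,c,\alpha)>0$ such that $$\mathbb{E}\,\mathrm{e}^{-\theta S_t^\delta}\le\exp\left[-C\,t^{\frac{\delta}{\alpha(1-\delta)+\delta}}\right]\quad\text{for all sufficiently large } t>1.$$ b) Let $\beta>0$. i) We have $$\mathbb{E}S_t^{-\beta}\ge\frac{1}{\mathrm{e}\,\beta\,\Gamma(\beta)}\left[\phi^{-1}\left(\tfrac1t\right)\right]^\beta\quad\text{for all } t>0.$$ ii) If the Bernstein function $\phi$ satisfies $$\liminf_{s\to\infty}\frac{\phi(s)}{\log s}>0\quad\text{and}\quad\liminf_{s\downarrow0}\frac{\phi(\lambda s)}{\phi(s)}>1\ \text{ for some (hence, all) }\lambda>1,$$ then there exists a $C=C(\beta)>0$ such that $$\mathbb{E}S_t^{-\beta}\le C\left[\phi^{-1}\left(\tfrac1t\right)\right]^\beta\quad\text{for all sufficiently large } t>1.$$ iii) If the Bernstein function $\phi$ satisfies $$\liminf_{s\to\infty}\frac{\phi(\lambda s)}{\phi(s)}>1\ \text{ for some (hence, all) }\lambda>1,$$ then there exists a $C=C(\beta)>0$ such that $$\mathbb{E}S_t^{-\beta}\le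 C\left[\phi^{-1}\left(\tfrac1t\right)\right]^\beta\quad\text{for all } t\in(0,1].$$ c) Let $\gamma>0$. i) If $\nu(\mathrm{d}y)\ge c\,y^{-1-\alpha}\,\mathrm{d}y$ for some constants $c>0$ and $\alpha\in(0,1)$, then there exists a $C=C(\gamma,c,\alpha)>0$ such that $$\mathbb{E}\log^{-\gamma}(1+S_t)\le C\log^{-\gamma}\left(1+t^{1/\alpha}\right)\quad\text{for all } t>0.$$ ii) If $\nu(\mathrm{d}y)=c\,y^{-1-\alpha}\,\mathrm{d}y$ for some constants $c>0$ and $\alpha\in(0,1)$, then there exists a $C=C(\gamma,c,\alpha)>0$ such that $$\mathbb{E}\log^{-\gamma}(1+S_t)\ge C\log^{-\gamma}\left(1+t^{1/\alpha}\right)\quad\text{for all } t>0.$$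
   Context: A subordinator (without killing) $S=\{S_t:t\ge0\}$ is a non-decreasing Lévy process on $[0,\infty)$ with Laplace transform $\mathbb{E}\,\mathrm{e}^{-uS_t}=\mathrm{e}^{-t\phi(u)}$, $u>0$, $t\ge0$. Its characteristic (Laplace) exponent $\phi:(0,\infty)\to(0,\infty)$ is a Bernstein function, i.e. $\phi$ is of class $C^\infty$ with $(-1)^{n-1}\phi^{(n)}\ge0$ for all $n=1,2,\dots$. Every such $\phi$ admits a unique (Lévy–Khintchine) representation $\phi(u)=bu+\int_{(0,\infty)}(1-\mathrm{e}^{-uy})\,\nu(\mathrm{d}y)$, $u>0$, where $b\ge0$ is the drift parameter and $\nu$ is a Lévy measure, i.e. a measure on $(0,\infty)$ satisfying $\int_{(0,\infty)}(y\wedge1)\,\nu(\mathrm{d}y)<\infty$. Any non-trivial Bernstein function is strictly increasing, and $\phi^{-1}$ denotes the inverse function of $\phi$. $\Gamma$ is the Gamma function, and $\log^{-\gamma}(x)$ means $(\log x)^{-\gamma}$.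
   Formalization: In c) ii) the drift b is assumed to be 0: for b>0 the bound fails as t→0, since S_t≥bt while α<1. In b) ii) and iii) the constant C may depend on φ as well as β; a C depending on β alone is impossible (φ(u)=u^a, a→0). *)

theory Defs
  imports "HOL-Probability.Probability"
begin

text \<open>Processes are families indexed by \<^typ>\<open>real\<close>; only times \<open>t \<ge> 0\<close> matter.
  Path properties are required almost surely.\<close>

definition cadlag_on_nonneg :: "(real \<Rightarrow> real) \<Rightarrow> bool" where
  "cadlag_on_nonneg f \<longleftrightarrow>
     (\<forall>t\<ge>0. (f \<longlongrightarrow> f t) (at_right t)) \<and>
     (\<forall>t>0. \<exists>l. (f \<longlongrightarrow> l) (at_left t))"

definition independent_increments :: "'a measure \<Rightarrow> (real \<Rightarrow> 'a \<Rightarrow> real) \<Rightarrow> bool" where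
  "independent_increments M X \<longleftrightarrow>
     (\<forall>(n::nat) (t::nat \<Rightarrow> real). 0 \<le> t 0 \<and> (\<forall>i<n. t i \<le> t (Suc i)) \<longrightarrow>
        prob_space.indep_vars M (\<lambda>_. borel) (\<lambda>i \<omega>. X (t (Suc i)) \<omega> - X (t i) \<omega>) {..<n})"

definition stationary_increments :: "'a measure \<Rightarrow> (real \<Rightarrow> 'a \<Rightarrow> real) \<Rightarrow> bool" where
  "stationary_increments M X \<longleftrightarrow>
     (\<forall>s t. 0 \<le> s \<and> s \<le> t \<longrightarrow>
        distr M borel (\<lambda>\<omega>. X t \<omega> - X s \<omega>) = distr M borel (X (t - s)))"

definition stochastically_continuous :: "'a measure \<Rightarrow> (real \<Rightarrow> 'a \<Rightarrow> real) \<Rightarrow> bool" where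
  "stochastically_continuous M X \<longleftrightarrow>
     (\<forall>t\<ge>0. \<forall>\<epsilon>>0.
        ((\<lambda>s. measure M {\<omega> \<in> space M. \<bar>X s \<omega> - X t \<omega>\<bar> > \<epsilon>}) \<longlongrightarrow> 0) (at t within {0..}))"

definition levy_process :: "'a measure \<Rightarrow> (real \<Rightarrow> 'a \<Rightarrow> real) \<Rightarrow> bool" where
  "levy_process M X \<longleftrightarrow>
     prob_space M \<and>
     (\<forall>t\<ge>0. X t \<in> borel_measurable M) \<and>
     (AE \<omega> in M. X 0 \<omega> = 0) \<and>
     independent_increments M X \<and>
     stationary_increments M X \<and>
     stochastically_continuous M X \<and>
     (AE \<omega> in M. cadlag_on_nonneg (\<lambda>t. X t \<omega>))"

text \<open>Nonnegativity of the values follows from \<open>S 0 = 0\<close> and monotonicity.\<close>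

definition subordinator :: "'a measure \<Rightarrow> (real \<Rightarrow> 'a \<Rightarrow> real) \<Rightarrow> bool" where
  "subordinator M S \<longleftrightarrow>
     levy_process M S \<and>
     (AE \<omega> in M. \<forall>s t. 0 \<le> s \<and> s \<le> t \<longrightarrow> S s \<omega> \<le> S t \<omega>)"

definition laplace_exponent ::
    "'a measure \<Rightarrow> (real \<Rightarrow> 'a \<Rightarrow> real) \<Rightarrow> (real \<Rightarrow> real) \<Rightarrow> bool" where
  "laplace_exponent M S \<phi> \<longleftrightarrow>
     (\<forall>u>0. \<forall>t\<ge>0. prob_space.expectation M (\<lambda>\<omega>. exp (- u * S t \<omega>)) = exp (- t * \<phi> u))"

text \<open>Strict positivity excludes the trivial function \<open>0\<close>. Values of \<open>\<phi>\<close> outside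
  \<open>(0,\<infinity>)\<close> are irrelevant.\<close>

definition bernstein_function :: "(real \<Rightarrow> real) \<Rightarrow> bool" where
  "bernstein_function \<phi> \<longleftrightarrow>
     (\<forall>u>0. \<phi> u > 0) \<and>
     (\<forall>n. \<forall>u>0. (deriv ^^ n) \<phi> differentiable (at u)) \<and>
     (\<forall>n\<ge>1. \<forall>u>0. (-1) ^ (n - 1) * (deriv ^^ n) \<phi> u \<ge> 0)"

text \<open>Measures on \<open>(0,\<infinity>)\<close> are represented as Borel measures on \<^typ>\<open>real\<close> that do not
  charge \<open>(-\<infinity>,0]\<close>.\<close>

definition levy_measure :: "real measure \<Rightarrow> bool" where
  "levy_measure \<nu> \<longleftrightarrow>
     sets \<nu> = sets borel \<and> emeasure \<nu> {..0} = 0 \<and>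
     (\<integral>\<^sup>+y\<in>{0<..}. ennreal (min y 1) \<partial>\<nu>) < \<infinity>"

definition levy_khintchine :: "(real \<Rightarrow> real) \<Rightarrow> real \<Rightarrow> real measure \<Rightarrow> bool" where
  "levy_khintchine \<phi> b \<nu> \<longleftrightarrow>
     b \<ge> 0 \<and> levy_measure \<nu> \<and>
     (\<forall>u>0. \<phi> u = b * u + (LINT y:{0<..}|\<nu>. 1 - exp (- u * y)))"

definition subordinator_with ::
    "'a measure \<Rightarrow> (real \<Rightarrow> 'a \<Rightarrow> real) \<Rightarrow> (real \<Rightarrow> real) \<Rightarrow> real \<Rightarrow> real measure \<Rightarrow> bool" where
  "subordinator_with M S \<phi> b \<nu> \<longleftrightarrow>
     subordinator M S \<and> bernstein_function \<phi> \<and> laplace_exponent M S \<phi> \<and> levy_khintchine \<phi> b \<nu>"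

text \<open>The measure \<open>c y\<^sup>-\<^sup>1\<^sup>-\<^sup>\<alpha> dy\<close> on \<open>(0,\<infinity>)\<close>. A subordinator said to have
  exactly this Levy measure is the stable one, i.e. its drift is \<open>0\<close>: with drift \<open>b > 0\<close> one
  has \<open>S\<^sub>t \<ge> b t\<close>, and lower bounds of the order of the stable scaling fail as \<open>t \<rightarrow> 0\<close>.\<close>

definition stable_measure :: "real \<Rightarrow> real \<Rightarrow> real measure" where
  "stable_measure c \<alpha> =
     density lborel (\<lambda>y. ennreal (c * y powr (- 1 - \<alpha>)) * indicator {0<..} y)"

definition dominates :: "real measure \<Rightarrow> real measure \<Rightarrow> bool" where
  "dominates \<nu> \<mu> \<longleftrightarrow> (\<forall>A\<in>sets borel. emeasure \<mu> A \<le> emeasure \<nu> A)"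

text \<open>The inverse of \<open>\<phi> : (0,\<infinity>) \<rightarrow> (0,\<infinity>)\<close>. A Bernstein function may be bounded (compound
  Poisson case); at levels \<open>s \<ge> \<phi>(\<infinity>)\<close>, which are not attained, the inverse is \<open>\<infinity>\<close>.
  It is only applied to \<open>s > 0\<close>.\<close>

definition bernstein_inv :: "(real \<Rightarrow> real) \<Rightarrow> real \<Rightarrow> ennreal" where
  "bernstein_inv \<phi> s =
     (if s \<in> \<phi> ` {0<..} then ennreal (the_inv_into {0<..} \<phi> s) else \<infinity>)"

definition ennreal_powr :: "ennreal \<Rightarrow> real \<Rightarrow> ennreal" where
  "ennreal_powr x p = (if x = \<infinity> then \<infinity> else ennreal (enn2real x powr p))"

text \<open>The expectations of \<open>S\<^sub>t\<^sup>-\<^sup>\<beta>\<close> and \<open>log\<^sup>-\<^sup>\<gamma>(1 + S\<^sub>t)\<close> take values in \<open>[0,\<infinity>]\<close>, with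
  \<open>0\<^sup>-\<^sup>p = \<infinity>\<close> for \<open>p > 0\<close>; this is what \<^const>\<open>inverse\<close> on \<^typ>\<open>ennreal\<close> gives.\<close>

definition neg_moment :: "'a measure \<Rightarrow> ('a \<Rightarrow> real) \<Rightarrow> real \<Rightarrow> ennreal" where
  "neg_moment M X \<beta> = (\<integral>\<^sup>+\<omega>. inverse (ennreal (X \<omega> powr \<beta>)) \<partial>M)"

definition neg_log_moment :: "'a measure \<Rightarrow> ('a \<Rightarrow> real) \<Rightarrow> real \<Rightarrow> ennreal" where
  "neg_log_moment M X \<gamma> = neg_moment M (\<lambda>\<omega>. ln (1 + X \<omega>)) \<gamma>"

end

theory Submission
  imports Defs
begin

text \<open>
  Since \<open>\<Gamma>(\<beta>) s\<^sup>-\<^sup>\<beta> = \<integral> u\<^sup>\<beta>\<^sup>-\<^sup>1 exp(-us) du\<close>, Tonelli turns the negative moment of \<open>S\<^sub>t\<close> into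
  \<open>1/\<Gamma>(\<beta>)\<close> times the integral of \<open>u\<^sup>\<beta>\<^sup>-\<^sup>1 exp(-t \<phi>(u))\<close>. Put \<open>z = \<phi>\<^sup>-\<^sup>1(1/t)\<close>. The part over \<open>(0, z)\<close> already
  gives the lower bound in (b). For the upper bounds, iterating \<open>\<phi>(r s) \<ge> \<kappa> \<phi>(s)\<close> gives
  \<open>t \<phi>(u) \<ge> (u/z)\<^sup>p / \<kappa>\<close> with \<open>p = log\<^sub>r \<kappa>\<close>, hence \<open>exp(-t \<phi>(u)) \<le> K (u/z)\<^sup>-\<^sup>\<beta>\<^sup>-\<^sup>1\<close> and an integral of order \<open>z\<^sup>\<beta>\<close>;
  for large \<open>t\<close> this only covers bounded \<open>u\<close>, and beyond that one factor \<open>exp(-t \<phi>(u)/2)\<close> supplies the power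
  of \<open>z\<close> while logarithmic growth of \<open>\<phi>\<close> makes the other one integrable.
  Domination of the stable Levy measure gives \<open>\<phi>(u) \<ge> a u\<^sup>\<alpha>\<close>. Then (a) follows from
  \<open>exp(-\<theta> x\<^sup>\<delta>) \<le> exp(-\<theta> k\<^sup>\<delta>\<^sup>-\<^sup>1 x) + exp(-\<theta> k\<^sup>\<delta>)\<close> by choosing \<open>k\<close> so that both terms have the same order.
  For (c), let \<open>T = t\<^sup>1\<^sup>/\<^sup>\<alpha>\<close> and \<open>R = S\<^sub>t / T\<close>; concavity of the logarithm compares \<open>log(1 + T R)\<close> with
  \<open>log(1 + T)\<close> up to the factors \<open>min(1, R)\<close> and \<open>1 + R \<le> exp R\<close>, which leaves \<open>E R\<^sup>-\<^sup>\<gamma>\<close> and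
  \<open>E exp(-\<gamma> R)\<close>, both controlled by \<open>\<phi>\<close>.
\<close>

subsection \<open>Power-weighted integrals and growth estimates\<close>

lemma nn_integral_powr_Ioc_0:
  fixes \<beta> w :: real
  assumes "\<beta> > 0" "w > 0"
  shows "(\<integral>\<^sup>+u\<in>{0<..w}. ennreal (u powr (\<beta> - 1)) \<partial>lborel) = ennreal (w powr \<beta> / \<beta>)"
proof -
  have "((\<lambda>u. u powr (\<beta> - 1)) has_integral (w powr \<beta> / \<beta>)) {0..w}"
    using has_integral_powr_from_0[of "\<beta> - 1" w] assms by simp
  hence "(\<integral>\<^sup>+u. ennreal (u powr (\<beta> - 1)) * indicator {0..w} u \<partial>lborel) = ennreal (w powr \<beta> / \<beta>)"
    by (intro nn_integral_has_integral_lebesgue') auto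
  \<comment> \<open>The integrands agree at \<open>u = 0\<close> as well, since
    \<open>0 powr x = 0\<close>.\<close>
  also have "(\<integral>\<^sup>+u. ennreal (u powr (\<beta> - 1)) * indicator {0..w} u \<partial>lborel) =
      (\<integral>\<^sup>+u\<in>{0<..w}. ennreal (u powr (\<beta> - 1)) \<partial>lborel)"
    by (intro nn_integral_cong) (auto simp: indicator_def)
  finally show ?thesis .
qed

lemma nn_integral_powr_Ioi_0:
  fixes \<beta> :: real
  assumes "\<beta> > 0"
  shows "(\<integral>\<^sup>+u\<in>{0<..}. ennreal (u powr (\<beta> - 1)) \<partial>lborel) = \<infinity>" (is "?I = _")
proof (rule ccontr)
  assume "?I \<noteq> \<infinity>"
  then obtain r where r: "r \<ge> 0" "?I = ennreal r"
    by (cases ?I) auto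
  \<comment> \<open>Solves \<open>w powr \<beta> / \<beta> = r + 1\<close>, so that the part below
    \<open>w\<close> alone exceeds the supposed finite value \<open>r\<close>.\<close>
  define w where "w = ((r + 1) * \<beta>) powr (1 / \<beta>)"
  have w: "w > 0" "w powr \<beta> / \<beta> = r + 1"
    using assms r by (auto simp: w_def powr_powr)
  have "ennreal (r + 1) = (\<integral>\<^sup>+u\<in>{0<..w}. ennreal (u powr (\<beta> - 1)) \<partial>lborel)"
    using nn_integral_powr_Ioc_0[OF assms w(1)] w(2) by simp
  also have "\<dots> \<le> ?I"
    by (intro nn_integral_mono) (auto simp: indicator_def)
  finally show False
    using r by simp
qed

text \<open>Substitute \<open>s * u\<close> in Euler's Gamma integral. For \<open>s = 0\<close> the
  integral diverges, which agrees with \<open>inverse 0\<close> being infinite in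
  \<open>ennreal\<close>.\<close>

lemma nn_integral_powr_exp:
  fixes \<beta> s :: real
  assumes \<beta>: "\<beta> > 0" and "s \<ge> 0"
  shows "(\<integral>\<^sup>+u\<in>{0<..}. ennreal (u powr (\<beta> - 1) * exp (- u * s)) \<partial>lborel)
           = ennreal (Gamma \<beta>) * inverse (ennreal (s powr \<beta>))"
proof (cases "s = 0")
  case True
  then show ?thesis
    using nn_integral_powr_Ioi_0[OF \<beta>] Gamma_real_pos[OF \<beta>] by (simp add: ennreal_mult_top)
next
  case False
  hence s: "s > 0" using assms by simp
  let ?I = "\<integral>\<^sup>+u\<in>{0<..}. ennreal (u powr (\<beta> - 1) * exp (- u * s)) \<partial>lborel"
  have "ennreal (Gamma \<beta>) =
      ennreal s * (\<integral>\<^sup>+u. ennreal (indicator {0..} (0 + s * u) * (0 + s * u) powr (\<beta> - 1) / exp (0 + s * u)) \<partial>lborel)"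
    unfolding Gamma_conv_nn_integral_real[OF \<beta>]
    by (subst nn_integral_real_affine[of _ s 0]) (use s in auto)
  also have "(\<integral>\<^sup>+u. ennreal (indicator {0..} (0 + s * u) * (0 + s * u) powr (\<beta> - 1) / exp (0 + s * u)) \<partial>lborel)
      = (\<integral>\<^sup>+u. ennreal (s powr (\<beta> - 1)) * (ennreal (u powr (\<beta> - 1) * exp (- u * s)) * indicator {0<..} u) \<partial>lborel)"
  proof (intro nn_integral_cong)
    fix u :: real
    show "ennreal (indicator {0..} (0 + s * u) * (0 + s * u) powr (\<beta> - 1) / exp (0 + s * u))
       = ennreal (s powr (\<beta> - 1)) * (ennreal (u powr (\<beta> - 1) * exp (- u * s)) * indicator {0<..} u)"
      using s by (cases u "0::real" rule: linorder_cases)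
        (auto simp: indicator_def zero_le_mult_iff powr_mult exp_minus field_simps
              simp flip: ennreal_mult)
  qed
  also have "\<dots> = ennreal (s powr (\<beta> - 1)) * ?I"
    by (rule nn_integral_cmult) simp
  also have "ennreal s * (ennreal (s powr (\<beta> - 1)) * ?I) = ennreal (s powr \<beta>) * ?I"
    using s powr_add[of s 1 "\<beta> - 1"]
    by (simp flip: mult.assoc ennreal_mult)
  finally have "inverse (ennreal (s powr \<beta>)) * ennreal (Gamma \<beta>)
      = (inverse (ennreal (s powr \<beta>)) * ennreal (s powr \<beta>)) * ?I"
    by (simp add: mult.assoc)
  also have "inverse (ennreal (s powr \<beta>)) * ennreal (s powr \<beta>) = 1"
    using s by (simp add: inverse_ennreal flip: ennreal_mult)
  finally show ?thesis
    by (simp add: mult.commute)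
qed

text \<open>The decay exponent \<open>\<beta> + 1\<close> makes the tail integrand \<open>K w\<^sup>\<beta>\<^sup>+\<^sup>1 u\<^sup>-\<^sup>2\<close>.\<close>

lemma nn_integral_powr_weight_le:
  fixes \<beta> w K :: real and g :: "real \<Rightarrow> real"
  assumes "\<beta> > 0" "w > 0" "K \<ge> 0"
    and g1: "\<And>u. 0 < u \<Longrightarrow> u \<le> w \<Longrightarrow> g u \<le> 1"
    and gK: "\<And>u. w \<le> u \<Longrightarrow> g u \<le> K * (u / w) powr - (\<beta> + 1)"
  shows "(\<integral>\<^sup>+u\<in>{0<..}. ennreal (u powr (\<beta> - 1) * g u) \<partial>lborel)
           \<le> ennreal ((1 / \<beta> + K) * w powr \<beta>)"
proof -
  let ?c = "K * w powr (\<beta> + 1)"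
  have tail: "u powr (\<beta> - 1) * g u \<le> ?c * u powr -2" if "w \<le> u" for u
  proof -
    have u: "u > 0" using that assms by linarith
    have "u powr (\<beta> - 1) * g u \<le> u powr (\<beta> - 1) * (K * (u / w) powr - (\<beta> + 1))"
      using gK[OF that] by (intro mult_left_mono) auto
    also have "\<dots> = ?c * (u powr (\<beta> - 1) * u powr - (\<beta> + 1))"
    proof -
      have "(u / w) powr - (\<beta> + 1) = u powr - (\<beta> + 1) * w powr (\<beta> + 1)"
        unfolding powr_minus using u assms by (simp add: powr_divide field_simps)
      thus ?thesis by (simp only: mult_ac)
    qed
    also have "u powr (\<beta> - 1) * u powr - (\<beta> + 1) = u powr -2"
      by (simp flip: powr_add)
    finally show ?thesis .
  qed
  \<comment> \<open>The domain is cut at \<open>w\<close>; counting the point \<open>w\<close> in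
    both pieces only enlarges the upper bound.\<close>
  have "(\<integral>\<^sup>+u\<in>{0<..}. ennreal (u powr (\<beta> - 1) * g u) \<partial>lborel) \<le>
      (\<integral>\<^sup>+u. ennreal (u powr (\<beta> - 1)) * indicator {0<..w} u
         + ennreal ?c * (ennreal (u powr -2) * indicator {w..} u) \<partial>lborel)"
  proof (intro nn_integral_mono)
    fix u :: real
    consider "u \<le> 0" | "0 < u" "u \<le> w" | "w < u" by linarith
    thus "ennreal (u powr (\<beta> - 1) * g u) * indicator {0<..} u \<le>
      ennreal (u powr (\<beta> - 1)) * indicator {0<..w} u
         + ennreal ?c * (ennreal (u powr -2) * indicator {w..} u)"
    proof cases
      case 2
      have "ennreal (u powr (\<beta> - 1) * g u) \<le> ennreal (u powr (\<beta> - 1))"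
        using mult_left_mono[OF g1[OF 2], of "u powr (\<beta> - 1)"] by (intro ennreal_leI) simp
      also have "\<dots> \<le> \<dots> + ennreal ?c * (ennreal (u powr -2) * indicator {w..} u)"
        by (rule add_increasing2) auto
      finally show ?thesis using 2 by simp
    next
      case 3
      then show ?thesis
        using tail[of u] assms(2,3) by (auto simp flip: ennreal_mult intro!: ennreal_leI)
    qed simp
  qed
  also have "\<dots> = ennreal (w powr \<beta> / \<beta>) + ennreal ?c * (\<integral>\<^sup>+u. ennreal (u powr -2) * indicator {w..} u \<partial>lborel)"
    using assms by (subst nn_integral_add)
      (auto simp: nn_integral_powr_Ioc_0 nn_integral_cmult)
  also have "(\<integral>\<^sup>+u. ennreal (u powr -2) * indicator {w..} u \<partial>lborel) = ennreal (w powr -1)"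
    using has_integral_powr_to_inf[of "-2" w] assms
    by (intro nn_integral_has_integral_lebesgue') auto
  also have "ennreal ?c * ennreal (w powr -1) = ennreal (K * w powr \<beta>)"
    using assms powr_add[of w "\<beta> + 1" "-1"] by (simp flip: ennreal_mult)
  finally show ?thesis
    using assms by (simp add: algebra_simps flip: ennreal_plus)
qed

text \<open>Exponential decay beats any power: \<open>x / k \<le> exp (x / k)\<close>, raised to the
  power \<open>k\<close>, bounds \<open>exp (- x)\<close> by a multiple of
  \<open>x powr - k\<close>.\<close>

lemma exp_minus_powr_le:
  fixes a p q :: real
  assumes "a > 0" "p > 0" "q > 0"
  obtains K where "K > 0" "\<And>v. v > 0 \<Longrightarrow> exp (- (a * v powr p)) \<le> K * v powr - q"
proof
  \<comment> \<open>With \<open>x = a * v powr p\<close>, this exponent makes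
    \<open>x powr k\<close> a multiple of \<open>v powr q\<close>.\<close>
  define k where "k = q / p"
  have k: "k > 0" using assms by (simp add: k_def)
  show "(k / a) powr k > 0"
    using k assms by simp
  fix v :: real assume v: "v > 0"
  define x where "x = a * v powr p"
  have x: "x > 0" using assms v by (simp add: x_def)
  have "x / k \<le> exp (x / k)"
    using exp_ge_add_one_self[of "x / k"] by linarith
  hence "(x / k) powr k \<le> exp (x / k) powr k"
    using k x by (intro powr_mono2) auto
  also have "\<dots> = exp x"
    using k by (simp add: powr_def)
  finally have *: "(x / k) powr k \<le> exp x" .
  have "exp (- x) = 1 / exp x" by (simp add: exp_minus field_simps)
  also have "\<dots> \<le> 1 / (x / k) powr k"
    using * x k by (intro divide_left_mono) auto
  also have "\<dots> = (k / a) powr k * v powr - q"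
    using assms k v by (simp add: x_def powr_divide powr_mult powr_powr powr_minus field_simps k_def)
  finally show "exp (- (a * v powr p)) \<le> (k / a) powr k * v powr - q"
    by (simp add: x_def)
qed

text \<open>Iterate the scaling inequality from \<open>z\<close> as often as possible without
  passing \<open>u\<close>, then use monotonicity. Asking for \<open>step\<close> only between
  \<open>z\<close> and \<open>u\<close> lets the bound serve scaling near 0 and near infinity
  alike.\<close>

lemma scaling_imp_powr_bound:
  fixes \<phi> :: "real \<Rightarrow> real"
  assumes mono: "\<And>s u. 0 < s \<Longrightarrow> s \<le> u \<Longrightarrow> \<phi> s \<le> \<phi> u"
    and pos: "\<phi> z > 0" and rk: "r > 1" "\<kappa> > 1" and z: "0 < z" "z \<le> u"
    and step: "\<And>s. z \<le> s \<Longrightarrow> r * s \<le> u \<Longrightarrow> \<kappa> * \<phi> s \<le> \<phi> (r * s)"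
  shows "(u / z) powr (log r \<kappa>) / \<kappa> * \<phi> z \<le> \<phi> u"
proof -
  have iter: "r ^ n * z \<le> u \<Longrightarrow> \<kappa> ^ n * \<phi> z \<le> \<phi> (r ^ n * z)" for n
  proof (induction n)
    case (Suc n)
    have "1 * (r ^ n * z) \<le> r * (r ^ n * z)"
      using rk z by (intro mult_right_mono) auto
    hence le: "r ^ n * z \<le> u" using Suc.prems by (simp add: mult.assoc)
    have "1 * z \<le> r ^ n * z"
      using rk z by (intro mult_right_mono) auto
    have "\<kappa> ^ Suc n * \<phi> z \<le> \<kappa> * \<phi> (r ^ n * z)"
      using Suc.IH[OF le] rk by simp
    also have "\<dots> \<le> \<phi> (r * (r ^ n * z))"
      using step[of "r ^ n * z"] Suc.prems \<open>1 * z \<le> _\<close> by (simp add: mult.assoc)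
    finally show ?case by (simp add: mult.assoc)
  qed simp
  \<comment> \<open>The number of complete steps by the factor \<open>r\<close>; dropping the
    fractional part of the logarithm costs at most one factor \<open>\<kappa>\<close>, whence the
    division by \<open>\<kappa>\<close>.\<close>
  define n where "n = nat \<lfloor>log r (u / z)\<rfloor>"
  have l0: "log r (u / z) \<ge> 0" using rk z by simp
  have n: "real n \<le> log r (u / z)" "log r (u / z) \<le> real n + 1"
    using l0 unfolding n_def by linarith+
  have "r powr real n \<le> u / z"
    using n(1) rk z by (simp add: le_log_iff)
  hence u: "r ^ n * z \<le> u"
    using rk z by (simp add: powr_realpow field_simps)
  have "(u / z) powr (log r \<kappa>) = \<kappa> powr (log r (u / z))"
    using rk z by (simp add: powr_def log_def)
  also have "\<dots> \<le> \<kappa> powr (real n + 1)"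
    using n rk by (intro powr_mono) auto
  also have "\<dots> = \<kappa> ^ n * \<kappa>"
    using rk by (simp add: powr_add powr_realpow)
  finally have "(u / z) powr (log r \<kappa>) / \<kappa> \<le> \<kappa> ^ n"
    using rk by (simp add: field_simps)
  hence "(u / z) powr (log r \<kappa>) / \<kappa> * \<phi> z \<le> \<kappa> ^ n * \<phi> z"
    using pos by (intro mult_right_mono) auto
  also have "\<dots> \<le> \<phi> (r ^ n * z)" using iter[OF u] .
  also have "\<dots> \<le> \<phi> u"
    using u rk z by (intro mono) auto
  finally show ?thesis .
qed

section \<open>Strict bounds on lower limits\<close>

lemma Liminf_ereal_gt_obtain:
  fixes c :: real
  assumes "Liminf F (\<lambda>s. ereal (f s)) > ereal c"
  obtains \<kappa> where "\<kappa> > c" "eventually (\<lambda>s. f s > \<kappa>) F"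
proof -
  obtain y where y: "ereal c < y" "y < Liminf F (\<lambda>s. ereal (f s))"
    using dense[OF assms] by blast
  \<comment> \<open>Lying strictly between two extended reals, \<open>y\<close> is finite even if
    the lower limit is infinite.\<close>
  then obtain \<kappa> where "y = ereal \<kappa>" by (cases y) auto
  thus ?thesis using y less_LiminfD[OF y(2)] that by auto
qed

lemma Liminf_ereal_gtI:
  fixes c \<kappa> :: real
  assumes "\<kappa> > c" "eventually (\<lambda>s. f s \<ge> \<kappa>) F"
  shows "Liminf F (\<lambda>s. ereal (f s)) > ereal c"
proof -
  have "ereal \<kappa> \<le> Liminf F (\<lambda>s. ereal (f s))"
    using assms(2) by (intro Liminf_bounded) (auto elim: eventually_mono)
  thus ?thesis using assms(1) by (metis less_ereal.simps(1) order_less_le_trans)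
qed

section \<open>Concavity of the logarithm\<close>

lemma ln_one_plus_mult_ge:
  fixes R T :: real
  assumes "0 \<le> R" "R \<le> 1" "T > 0"
  shows "R * ln (1 + T) \<le> ln (1 + T * R)"
proof -
  \<comment> \<open>\<open>1 + T * R\<close> is the convex combination of \<open>1\<close> and
    \<open>1 + T\<close> with weight \<open>R\<close>.\<close>
  have "(1 - R) * ln 1 + R * ln (1 + T) \<le> ln ((1 - R) *\<^sub>R 1 + R *\<^sub>R (1 + T))"
    using assms by (intro concave_onD[OF ln_concave]) auto
  thus ?thesis by (simp add: algebra_simps)
qed

lemma ln_one_plus_mult_le:
  fixes R T :: real
  assumes "R \<ge> 0" "T > 0"
  shows "ln (1 + T * R) \<le> (1 + R) * ln (1 + T)"
proof -
  have T0: "ln (1 + T) \<ge> 0" using assms by simp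
  show ?thesis
  proof (cases "R \<le> 1")
    case True
    have "ln (1 + T * R) \<le> 1 * ln (1 + T)"
      using True assms by (simp add: add_pos_nonneg mult_left_le)
    also have "\<dots> \<le> (1 + R) * ln (1 + T)"
      using assms T0 by (intro mult_right_mono) auto
    finally show ?thesis .
  next
    case False
    \<comment> \<open>For \<open>R > 1\<close> the roles are exchanged: \<open>1 + T\<close> lies
      between \<open>1\<close> and \<open>1 + T * R\<close>, with weight
      \<open>1 / R\<close>.\<close>
    have "ln (1 + T * R) \<le> R * ln (1 + T)"
      using ln_one_plus_mult_ge[of "1 / R" "T * R"] False assms by (simp add: field_simps)
    also have "\<dots> \<le> (1 + R) * ln (1 + T)"
      using assms T0 by (intro mult_right_mono) auto
    finally show ?thesis .
  qed
qed

subsection \<open>Laplace exponents and negative moments\<close>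

text \<open>The marginal laws of a subordinator as seen through their Laplace transforms; the moment
  bounds are derived in this setting.\<close>

locale laplace_family = prob_space M for M :: "'a measure" +
  fixes S :: "real \<Rightarrow> 'a \<Rightarrow> real" and \<phi> :: "real \<Rightarrow> real"
  assumes rv [measurable]: "t \<ge> 0 \<Longrightarrow> random_variable borel (S t)"
    and nonneg: "t \<ge> 0 \<Longrightarrow> AE \<omega> in M. 0 \<le> S t \<omega>"
    and laplace: "u > 0 \<Longrightarrow> t \<ge> 0 \<Longrightarrow> expectation (\<lambda>\<omega>. exp (- u * S t \<omega>)) = exp (- t * \<phi> u)"
    and bernstein: "bernstein_function \<phi>"
begin

lemma pos: "u > 0 \<Longrightarrow> \<phi> u > 0"
  using bernstein by (simp add: bernstein_function_def)

lemma AE_exp_le_1: "u \<ge> 0 \<Longrightarrow> t \<ge> 0 \<Longrightarrow> AE \<omega> in M. exp (- u * S t \<omega>) \<le> 1"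
  using nonneg[of t] by (auto elim!: eventually_mono)

lemma integrable_exp:
  assumes "u \<ge> 0" "t \<ge> 0"
  shows "integrable M (\<lambda>\<omega>. exp (- u * S t \<omega>))"
  using AE_exp_le_1[OF assms] assms(2) by (intro integrable_const_bound[where B = 1]) auto

lemma exponent_mono:
  assumes "0 < u" "u \<le> v"
  shows "\<phi> u \<le> \<phi> v"
proof -
  have "expectation (\<lambda>\<omega>. exp (- v * S 1 \<omega>)) \<le> expectation (\<lambda>\<omega>. exp (- u * S 1 \<omega>))"
    using nonneg[of 1] assms
    by (intro integral_mono_AE integrable_exp) (auto elim!: eventually_mono intro: mult_right_mono)
  thus ?thesis
    using laplace[of u 1] laplace[of v 1] assms by simp
qed

text \<open>If \<open>\<phi> u = \<phi> v\<close>, then \<open>e\<^sup>-\<^sup>u\<^sup>S\<close> and \<open>e\<^sup>-\<^sup>v\<^sup>S\<close> have equal means and are ordered, so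
  \<open>S\<^sub>1 = 0\<close> almost surely and \<open>\<phi> u = 0\<close>.\<close>

lemma exponent_strict_mono:
  assumes "0 < u" "u < v"
  shows "\<phi> u < \<phi> v"
proof (rule ccontr)
  assume "\<not> \<phi> u < \<phi> v"
  with exponent_mono[of u v] assms have eq: "\<phi> u = \<phi> v" by simp
  let ?f = "\<lambda>\<omega>. exp (- u * S 1 \<omega>) - exp (- v * S 1 \<omega>)"
  have int: "integrable M ?f"
    using assms by (intro Bochner_Integration.integrable_diff integrable_exp) auto
  have "expectation ?f = 0"
    using eq laplace[of u 1] laplace[of v 1] integrable_exp[of u 1] integrable_exp[of v 1] assms
    by (simp add: Bochner_Integration.integral_diff)
  moreover have "AE \<omega> in M. 0 \<le> ?f \<omega>"
    using nonneg[of 1] assms by (auto elim!: eventually_mono intro: mult_right_mono)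
  ultimately have "AE \<omega> in M. ?f \<omega> = 0"
    using integral_nonneg_eq_0_iff_AE[OF int] by simp
  hence "AE \<omega> in M. exp (- u * S 1 \<omega>) = 1"
    using assms by (auto elim!: eventually_mono)
  hence "expectation (\<lambda>\<omega>. exp (- u * S 1 \<omega>)) = expectation (\<lambda>\<omega>. 1)"
    by (intro integral_cong_AE) auto
  thus False
    using laplace[of u 1] pos[of u] assms by (simp add: prob_space)
qed

lemma exponent_less_iff: "u > 0 \<Longrightarrow> v > 0 \<Longrightarrow> \<phi> u < \<phi> v \<longleftrightarrow> u < v"
  by (metis exponent_strict_mono linorder_neqE order_less_asym)

lemma exponent_le_iff: "u > 0 \<Longrightarrow> v > 0 \<Longrightarrow> \<phi> u \<le> \<phi> v \<longleftrightarrow> u \<le> v"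
  using exponent_less_iff[of v u] by linarith

lemma inj_on_exponent: "inj_on \<phi> {0<..}"
  by (rule inj_onI) (metis exponent_strict_mono greaterThan_iff linorder_neqE order_less_irrefl)

text \<open>Since \<open>S 1\<close> is finite, dominated convergence along
  \<open>u = 1 / (n + 1)\<close> shows that the mean of \<open>exp (- u * S 1)\<close> tends to 1,
  hence \<open>\<phi> u\<close> tends to 0.\<close>

lemma exponent_small:
  assumes "s > 0"
  obtains u where "u > 0" "\<phi> u < s"
proof -
  have "(\<lambda>n. expectation (\<lambda>\<omega>. exp (- inverse (real (Suc n)) * S 1 \<omega>)))
          \<longlonglongrightarrow> expectation (\<lambda>\<omega>. exp (- 0 * S 1 \<omega>))"
  proof (rule integral_dominated_convergence[where w = "\<lambda>_. 1"])
    show "AE \<omega> in M. (\<lambda>n. exp (- inverse (real (Suc n)) * S 1 \<omega>)) \<longlonglongrightarrow> exp (- 0 * S 1 \<omega>)"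
      by (intro AE_I2 tendsto_intros LIMSEQ_inverse_real_of_nat)
    show "AE \<omega> in M. norm (exp (- inverse (real (Suc n)) * S 1 \<omega>)) \<le> 1" for n
      using AE_exp_le_1[of "inverse (real (Suc n))" 1] by simp
  qed auto
  hence "(\<lambda>n. exp (- \<phi> (inverse (real (Suc n))))) \<longlonglongrightarrow> 1"
    by (simp add: laplace[of _ 1, simplified] prob_space)
  moreover have "exp (- s) < 1" using assms by simp
  ultimately have "eventually (\<lambda>n. exp (- s) < exp (- \<phi> (inverse (real (Suc n))))) sequentially"
    by (rule order_tendstoD)
  then obtain n where "exp (- s) < exp (- \<phi> (inverse (real (Suc n))))"
    by (auto simp: eventually_sequentially)
  thus ?thesis using that[of "inverse (real (Suc n))"] by simp
qed

lemma has_derivative_exponent: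
  assumes "u > 0"
  shows "((deriv ^^ n) \<phi> has_real_derivative (deriv ^^ Suc n) \<phi> u) (at u)"
proof -
  have "(deriv ^^ n) \<phi> differentiable (at u)"
    using bernstein assms by (simp add: bernstein_function_def)
  thus ?thesis
    by (simp add: DERIV_deriv_iff_real_differentiable)
qed

lemma continuous_on_exponent: "continuous_on {0<..} \<phi>"
  using has_derivative_exponent[of _ 0]
  by (intro continuous_at_imp_continuous_on) (auto intro: DERIV_isCont)

text \<open>The Bernstein condition at order 2 gives the sign of the second derivative. Concavity is
  what allows passing to a smaller factor in \<open>exponent_ratio_transfer\<close>.\<close>

lemma exponent_concave: "concave_on {0<..} \<phi>"
proof (rule f''_le0_imp_concave)
  fix u :: real assume u: "u \<in> {0<..}"
  show "(\<phi> has_real_derivative deriv \<phi> u) (at u)"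
    using has_derivative_exponent[of u 0] u by simp
  show "(deriv \<phi> has_real_derivative (deriv ^^ 2) \<phi> u) (at u)"
    using has_derivative_exponent[of u 1] u by (simp add: numeral_2_eq_2)
  have "(-1) ^ (2 - 1) * (deriv ^^ 2) \<phi> u \<ge> 0"
    using bernstein u unfolding bernstein_function_def
    by (metis greaterThan_iff one_le_numeral)
  thus "(deriv ^^ 2) \<phi> u \<le> 0" by simp
qed auto

text \<open>Intermediate value theorem between \<open>v\<close> and a point from
  \<open>exponent_small\<close> where \<open>\<phi>\<close> is below \<open>s\<close>.\<close>

lemma exponent_surj:
  assumes "s > 0" "v > 0" "s \<le> \<phi> v"
  obtains z where "z > 0" "z \<le> v" "\<phi> z = s"
proof -
  obtain u where u: "u > 0" "\<phi> u < s" using exponent_small[OF assms(1)] .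
  hence "u \<le> v" using exponent_le_iff[of u v] assms by linarith
  moreover have "continuous_on {u..v} \<phi>"
    using continuous_on_exponent by (rule continuous_on_subset) (use u in auto)
  ultimately obtain z where "u \<le> z" "z \<le> v" "\<phi> z = s"
    using IVT'[of \<phi> u s v] u assms by auto
  thus ?thesis using that[of z] u by linarith
qed

section \<open>The inverse exponent, at attained and unattained levels\<close>

lemma bernstein_inv_eq:
  assumes "z > 0"
  shows "bernstein_inv \<phi> (\<phi> z) = ennreal z"
  using assms inj_on_exponent by (auto simp: bernstein_inv_def the_inv_into_f_f)

lemma ennreal_powr_bernstein_inv:
  assumes "z > 0"
  shows "ennreal_powr (bernstein_inv \<phi> (\<phi> z)) \<beta> = ennreal (z powr \<beta>)"
  using assms by (simp add: bernstein_inv_eq ennreal_powr_def)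

text \<open>The second alternative occurs for bounded exponents; bounds that must cover every level
  treat the two cases separately.\<close>

lemma bernstein_inv_cases:
  assumes "s > 0"
  obtains z where "z > 0" "\<phi> z = s" | "\<And>u. u > 0 \<Longrightarrow> \<phi> u < s" "bernstein_inv \<phi> s = \<infinity>"
proof (cases "\<exists>v>0. s \<le> \<phi> v")
  case True
  then show ?thesis using exponent_surj[OF assms] that(1) by metis
next
  case False
  moreover have "s \<notin> \<phi> ` {0<..}" using False by force
  ultimately show ?thesis using that(2) by (auto simp: bernstein_inv_def not_le)
qed

lemma neg_moment_formula:
  assumes "\<beta> > 0" "t \<ge> 0"
  shows "ennreal (Gamma \<beta>) * neg_moment M (S t) \<beta> =
           (\<integral>\<^sup>+u\<in>{0<..}. ennreal (u powr (\<beta> - 1) * exp (- t * \<phi> u)) \<partial>lborel)"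
proof -
  interpret pair_sigma_finite M lborel ..
  have [measurable]: "S t \<in> borel_measurable M" using assms by simp
  have "ennreal (Gamma \<beta>) * neg_moment M (S t) \<beta> =
     (\<integral>\<^sup>+\<omega>. ennreal (Gamma \<beta>) * inverse (ennreal (S t \<omega> powr \<beta>)) \<partial>M)"
    unfolding neg_moment_def by (rule nn_integral_cmult[symmetric]) measurable
  \<comment> \<open>The Gamma integral requires \<open>S t \<omega> \<ge> 0\<close>, so the identity
    holds almost everywhere; where \<open>S t \<omega> = 0\<close>, both sides are infinite.\<close>
  also have "\<dots> = (\<integral>\<^sup>+\<omega>. (\<integral>\<^sup>+u\<in>{0<..}. ennreal (u powr (\<beta> - 1) * exp (- u * S t \<omega>)) \<partial>lborel) \<partial>M)"
    using nonneg[OF assms(2)]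
    by (intro nn_integral_cong_AE, eventually_elim) (rule nn_integral_powr_exp[OF assms(1), symmetric])
  also have "\<dots> = (\<integral>\<^sup>+u. (\<integral>\<^sup>+\<omega>. ennreal (u powr (\<beta> - 1) * exp (- u * S t \<omega>)) * indicator {0<..} u \<partial>M) \<partial>lborel)"
    by (rule Fubini'[symmetric]) measurable
  also have "\<dots> = (\<integral>\<^sup>+u\<in>{0<..}. ennreal (u powr (\<beta> - 1) * exp (- t * \<phi> u)) \<partial>lborel)"
  proof (intro nn_integral_cong)
    fix u :: real
    show "(\<integral>\<^sup>+\<omega>. ennreal (u powr (\<beta> - 1) * exp (- u * S t \<omega>)) * indicator {0<..} u \<partial>M)
        = ennreal (u powr (\<beta> - 1) * exp (- t * \<phi> u)) * indicator {0<..} u"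
    proof (cases "u > 0")
      case True
      have "(\<integral>\<^sup>+\<omega>. ennreal (u powr (\<beta> - 1) * exp (- u * S t \<omega>)) \<partial>M)
          = ennreal (expectation (\<lambda>\<omega>. u powr (\<beta> - 1) * exp (- u * S t \<omega>)))"
        using True assms integrable_exp[of u t] by (intro nn_integral_eq_integral) auto
      thus ?thesis using True laplace[OF True assms(2)] by simp
    qed simp
  qed
  finally show ?thesis .
qed

text \<open>In the applications \<open>w\<close> is the scale at which \<open>t * \<phi>\<close>
  becomes of order 1. Below it the exponential is at most 1, above it the power decay makes the
  integral converge, and each range contributes order \<open>w powr \<beta>\<close>.\<close>

lemma neg_moment_le:
  assumes "\<beta> > 0" "t \<ge> 0" "w > 0" "K \<ge> 0"
    and "\<And>u. w \<le> u \<Longrightarrow> exp (- t * \<phi> u) \<le> K * (u / w) powr - (\<beta> + 1)"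
  shows "neg_moment M (S t) \<beta> \<le> ennreal ((1 / \<beta> + K) / Gamma \<beta> * w powr \<beta>)"
proof -
  have G: "Gamma \<beta> > 0" using assms by (simp add: Gamma_real_pos)
  have "ennreal (Gamma \<beta>) * neg_moment M (S t) \<beta> \<le> ennreal ((1 / \<beta> + K) * w powr \<beta>)"
    unfolding neg_moment_formula[OF assms(1,2)]
    using assms pos by (intro nn_integral_powr_weight_le) (auto intro!: mult_nonneg_nonneg less_imp_le[OF pos])
  also have "\<dots> = ennreal (Gamma \<beta>) * ennreal ((1 / \<beta> + K) / Gamma \<beta> * w powr \<beta>)"
    using assms less_imp_neq[OF G] by (simp flip: ennreal_mult)
  finally show ?thesis
    using G by (subst (asm) ennreal_mult_le_mult_iff) auto
qed

lemma neg_moment_ge_bernstein_inv: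
  assumes "\<beta> > 0" "t > 0"
  shows "ennreal (1 / (exp 1 * \<beta> * Gamma \<beta>)) * ennreal_powr (bernstein_inv \<phi> (1 / t)) \<beta>
           \<le> neg_moment M (S t) \<beta>"
proof -
  have G: "Gamma \<beta> > 0" using assms by (simp add: Gamma_real_pos)
  let ?I = "\<integral>\<^sup>+u\<in>{0<..}. ennreal (u powr (\<beta> - 1) * exp (- t * \<phi> u)) \<partial>lborel"
  \<comment> \<open>Where \<open>\<phi> u \<le> 1 / t\<close>, the exponential is at least
    \<open>exp (- 1)\<close>, the source of \<open>exp 1\<close> in the constant. \<open>A\<close>
    will be \<open>{0<..z}\<close> or, if the level is never reached, the whole half-line.\<close>
  have lower: "ennreal (exp (- 1)) * (\<integral>\<^sup>+u\<in>A. ennreal (u powr (\<beta> - 1)) \<partial>lborel) \<le> ?I"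
    if "A \<in> sets borel" "A \<subseteq> {0<..}" "\<And>u. u \<in> A \<Longrightarrow> \<phi> u \<le> 1 / t" for A
  proof -
    have "ennreal (exp (- 1)) * (\<integral>\<^sup>+u\<in>A. ennreal (u powr (\<beta> - 1)) \<partial>lborel) =
        (\<integral>\<^sup>+u. ennreal (exp (- 1)) * (ennreal (u powr (\<beta> - 1)) * indicator A u) \<partial>lborel)"
      using that(1) by (intro nn_integral_cmult[symmetric]) auto
    also have "\<dots> \<le> ?I"
    proof (intro nn_integral_mono)
      fix u :: real
      show "ennreal (exp (- 1)) * (ennreal (u powr (\<beta> - 1)) * indicator A u) \<le>
          ennreal (u powr (\<beta> - 1) * exp (- t * \<phi> u)) * indicator {0<..} u"
      proof (cases "u \<in> A")
        case True
        hence "t * \<phi> u \<le> 1" using that(3)[of u] assms by (simp add: field_simps)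
        hence "exp (- 1) * u powr (\<beta> - 1) \<le> u powr (\<beta> - 1) * exp (- t * \<phi> u)"
          by (subst mult.commute) (auto intro: mult_left_mono)
        thus ?thesis using True that(2) by (auto simp flip: ennreal_mult intro: ennreal_leI)
      qed simp
    qed
    finally show ?thesis .
  qed
  have t: "1 / t > 0" using assms by simp
  have *: "ennreal (1 / \<beta>) * ennreal_powr (bernstein_inv \<phi> (1 / t)) \<beta> * ennreal (exp (- 1)) \<le> ?I"
    using t
  proof (cases rule: bernstein_inv_cases)
    case (1 z)
    have "ennreal (exp (- 1)) * (\<integral>\<^sup>+u\<in>{0<..z}. ennreal (u powr (\<beta> - 1)) \<partial>lborel) \<le> ?I"
      using 1 exponent_mono by (intro lower) (auto simp flip: 1(2))
    thus ?thesis
      using 1 assms ennreal_powr_bernstein_inv[of z \<beta>]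
      by (simp add: nn_integral_powr_Ioc_0) (simp add: mult_ac flip: ennreal_mult)
  next
    \<comment> \<open>Here \<open>\<phi>\<close> stays below \<open>1 / t\<close>, so the pure power
      is integrated over the half-line and both sides are infinite.\<close>
    case 2
    have "ennreal (exp (- 1)) * (\<integral>\<^sup>+u\<in>{0<..}. ennreal (u powr (\<beta> - 1)) \<partial>lborel) \<le> ?I"
      using 2 by (intro lower) (auto intro: less_imp_le)
    thus ?thesis
      using assms by (simp add: nn_integral_powr_Ioi_0 ennreal_mult_top top_unique)
  qed
  let ?X = "ennreal_powr (bernstein_inv \<phi> (1 / t)) \<beta>"
  have "ennreal (Gamma \<beta>) * (ennreal (1 / (exp 1 * \<beta> * Gamma \<beta>)) * ?X)
      = ennreal (Gamma \<beta> * (1 / (exp 1 * \<beta> * Gamma \<beta>))) * ?X"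
    using G assms by (subst ennreal_mult) (simp_all add: mult.assoc)
  also have "Gamma \<beta> * (1 / (exp 1 * \<beta> * Gamma \<beta>)) = 1 / \<beta> * exp (- 1)"
    using G assms less_imp_neq[OF G] by (simp add: exp_minus field_simps)
  also have "ennreal (1 / \<beta> * exp (- 1)) * ?X = ennreal (1 / \<beta>) * ?X * ennreal (exp (- 1))"
    using assms by (subst ennreal_mult) (simp_all add: mult_ac)
  also have "\<dots> \<le> ennreal (Gamma \<beta>) * neg_moment M (S t) \<beta>"
    using * assms by (simp add: neg_moment_formula)
  finally show ?thesis
    using G by (subst (asm) ennreal_mult_le_mult_iff) auto
qed

text \<open>A larger factor is handled by monotonicity, a smaller one by concavity, as
  \<open>r' * s\<close> then lies between \<open>s\<close> and \<open>r * s\<close>. The new bound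
  is uniform in \<open>s\<close>.\<close>

lemma exponent_ratio_transfer:
  assumes "r > 1" "r' > 1" "\<kappa> > 1"
  obtains \<kappa>' where "\<kappa>' > 1" "\<And>s. s > 0 \<Longrightarrow> \<phi> (r * s) / \<phi> s > \<kappa> \<Longrightarrow> \<phi> (r' * s) / \<phi> s \<ge> \<kappa>'"
proof (cases "r \<le> r'")
  case True
  show ?thesis
  proof (rule that[OF assms(3)])
    fix s :: real assume s: "s > 0" "\<phi> (r * s) / \<phi> s > \<kappa>"
    have "\<phi> (r * s) \<le> \<phi> (r' * s)" using True s assms by (intro exponent_mono) auto
    hence "\<phi> (r * s) / \<phi> s \<le> \<phi> (r' * s) / \<phi> s" using pos[OF s(1)] by (intro divide_right_mono) auto
    thus "\<phi> (r' * s) / \<phi> s \<ge> \<kappa>" using s by linarith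
  qed
next
  case False
  \<comment> \<open>The weight for which
    \<open>(1 - \<mu>) * s + \<mu> * (r * s) = r' * s\<close>.\<close>
  define \<mu> where "\<mu> = (r' - 1) / (r - 1)"
  have \<mu>: "0 < \<mu>" "\<mu> \<le> 1" using assms False by (auto simp: \<mu>_def)
  show ?thesis
  proof (rule that)
    show "1 + \<mu> * (\<kappa> - 1) > 1" using \<mu> assms by simp
    fix s :: real assume s: "s > 0" "\<phi> (r * s) / \<phi> s > \<kappa>"
    have "(1 - \<mu>) * s + \<mu> * (r * s) = (1 + \<mu> * (r - 1)) * s" by (simp add: algebra_simps)
    also have "1 + \<mu> * (r - 1) = r'" using assms by (simp add: \<mu>_def)
    finally have "(1 - \<mu>) * \<phi> s + \<mu> * \<phi> (r * s) \<le> \<phi> (r' * s)"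
      using concave_onD[OF exponent_concave, of \<mu> s "r * s"] \<mu> s assms by simp
    hence "((1 - \<mu>) * \<phi> s + \<mu> * \<phi> (r * s)) / \<phi> s \<le> \<phi> (r' * s) / \<phi> s"
      using pos[OF s(1)] by (intro divide_right_mono) auto
    also have "((1 - \<mu>) * \<phi> s + \<mu> * \<phi> (r * s)) / \<phi> s = 1 + \<mu> * (\<phi> (r * s) / \<phi> s - 1)"
      using pos[OF s(1)] by (simp add: field_simps)
    finally have "1 + \<mu> * (\<phi> (r * s) / \<phi> s - 1) \<le> \<phi> (r' * s) / \<phi> s" .
    moreover have "\<mu> * (\<kappa> - 1) \<le> \<mu> * (\<phi> (r * s) / \<phi> s - 1)"
      using s \<mu> by (intro mult_left_mono) auto
    ultimately show "1 + \<mu> * (\<kappa> - 1) \<le> \<phi> (r' * s) / \<phi> s" by linarith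
  qed
qed

text \<open>Scaling for some factor gives scaling for all; the filter is general in order to cover
  both 0 and infinity.\<close>

lemma Liminf_ratio_transfer:
  assumes "r > 1" "Liminf F (\<lambda>s. ereal (\<phi> (r * s) / \<phi> s)) > 1" "r' > 1"
    and F: "eventually (\<lambda>s. s > 0) F"
  shows "Liminf F (\<lambda>s. ereal (\<phi> (r' * s) / \<phi> s)) > 1"
proof -
  obtain \<kappa> where \<kappa>: "\<kappa> > 1" "eventually (\<lambda>s. \<phi> (r * s) / \<phi> s > \<kappa>) F"
    using Liminf_ereal_gt_obtain[OF assms(2)[unfolded one_ereal_def]] .
  obtain \<kappa>' where \<kappa>': "\<kappa>' > 1"
      "\<And>s. s > 0 \<Longrightarrow> \<phi> (r * s) / \<phi> s > \<kappa> \<Longrightarrow> \<phi> (r' * s) / \<phi> s \<ge> \<kappa>'"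
    using exponent_ratio_transfer[OF assms(1,3) \<kappa>(1)] by blast
  have "eventually (\<lambda>s. \<phi> (r' * s) / \<phi> s \<ge> \<kappa>') F"
    using \<kappa>(2) F by eventually_elim (rule \<kappa>'(2))
  from Liminf_ereal_gtI[OF \<kappa>'(1) this] show ?thesis by (simp add: one_ereal_def)
qed

end

subsection \<open>Moment bounds\<close>

context laplace_family
begin

text \<open>For \<open>t \<le> 1\<close> the level \<open>1 / t\<close> is at least 1, so its
  preimage \<open>z\<close> stays away from 0, but \<open>z\<close> may lie below the range where
  scaling is known. Replacing \<open>z\<close> by \<open>max z s1\<close> costs only a bounded
  factor.\<close>

lemma neg_moment_le_small_time:
  assumes \<beta>: "\<beta> > 0" and r: "r > 1" and L: "Liminf at_top (\<lambda>s. ereal (\<phi> (r * s) / \<phi> s)) > 1"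
  shows "\<exists>C>0. \<forall>t\<in>{0<..1}.
           neg_moment M (S t) \<beta> \<le> ennreal C * ennreal_powr (bernstein_inv \<phi> (1 / t)) \<beta>"
proof -
  obtain \<kappa> where \<kappa>: "\<kappa> > 1" "eventually (\<lambda>s. \<phi> (r * s) / \<phi> s > \<kappa>) at_top"
    using Liminf_ereal_gt_obtain[OF L[unfolded one_ereal_def]] .
  then obtain s1' where s1': "\<And>s. s \<ge> s1' \<Longrightarrow> \<phi> (r * s) / \<phi> s > \<kappa>"
    by (auto simp: eventually_at_top_linorder)
  define s1 where "s1 = max s1' 1"
  have step: "\<kappa> * \<phi> s \<le> \<phi> (r * s)" if "s \<ge> s1" for s
    using s1'[of s] that pos[of s] by (auto simp: s1_def field_simps)
  have s1: "s1 > 0" by (simp add: s1_def)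
  define p where "p = log r \<kappa>"
  have p: "p > 0" using r \<kappa> by (simp add: p_def)
  obtain K where K: "K > 0" "\<And>v. v > 0 \<Longrightarrow> exp (- (1 / \<kappa> * v powr p)) \<le> K * v powr - (\<beta> + 1)"
    using exp_minus_powr_le[of "1 / \<kappa>" p "\<beta> + 1"] p \<kappa> \<beta> by auto
  \<comment> \<open>A lower bound for \<open>z\<close> that holds for all \<open>t \<le> 1\<close>
    at once.\<close>
  obtain u0 where u0: "u0 > 0" "\<phi> u0 < 1" using exponent_small[of 1] by auto
  \<comment> \<open>Chosen so that \<open>s1 \<le> m * u0 \<le> m * z\<close>, hence
    \<open>max z s1 \<le> m * z\<close>.\<close>
  define m where "m = max 1 (s1 / u0)"
  have m: "m \<ge> 1" by (simp add: m_def)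
  define D where "D = (1 / \<beta> + K) / Gamma \<beta>"
  have D: "D > 0" using \<beta> K by (auto simp: D_def Gamma_real_pos add_pos_pos)
  have "neg_moment M (S t) \<beta> \<le> ennreal (D * m powr \<beta>) * ennreal_powr (bernstein_inv \<phi> (1 / t)) \<beta>"
    if t: "t \<in> {0<..1}" for t
  proof -
    have "1 / t > 0" using t by simp
    thus ?thesis
    proof (cases rule: bernstein_inv_cases)
      case (1 z)
      have "\<phi> u0 < \<phi> z" using u0(2) 1(2) t by (auto intro: less_le_trans)
      hence z: "u0 < z" using exponent_less_iff[OF u0(1) 1(1)] by simp
      define w where "w = max z s1"
      have w: "w > 0" "z \<le> w" "s1 \<le> w" using s1 by (auto simp: w_def)
      have "1 = t * \<phi> z" using 1 t by simp
      also have "\<dots> \<le> t * \<phi> w" using exponent_mono[OF 1(1) w(2)] t by (intro mult_left_mono) auto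
      finally have tw: "1 \<le> t * \<phi> w" .
      have "s1 = s1 / u0 * u0" using u0 by simp
      also have "\<dots> \<le> m * z"
        using z u0 s1 by (intro mult_mono) (auto simp: m_def)
      moreover have "1 * z \<le> m * z" using m 1 by (intro mult_right_mono) auto
      ultimately have wm: "w \<le> m * z" by (simp add: w_def)
      have "neg_moment M (S t) \<beta> \<le> ennreal (D * w powr \<beta>)"
        unfolding D_def
      proof (rule neg_moment_le)
        fix u assume u: "w \<le> u"
        have "(u / w) powr p / \<kappa> * \<phi> w \<le> \<phi> u"
          unfolding p_def using u w r \<kappa> step exponent_mono pos[OF w(1)]
          by (intro scaling_imp_powr_bound) auto
        hence "t * ((u / w) powr p / \<kappa> * \<phi> w) \<le> t * \<phi> u"
          using t by (intro mult_left_mono) auto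
        hence "(u / w) powr p / \<kappa> * (t * \<phi> w) \<le> t * \<phi> u"
          by (simp only: mult_ac)
        moreover have "(u / w) powr p / \<kappa> * 1 \<le> (u / w) powr p / \<kappa> * (t * \<phi> w)"
          using tw \<kappa> by (intro mult_left_mono) auto
        ultimately have "exp (- t * \<phi> u) \<le> exp (- (1 / \<kappa> * (u / w) powr p))" by simp
        also have "\<dots> \<le> K * (u / w) powr - (\<beta> + 1)"
          using u w by (intro K) auto
        finally show "exp (- t * \<phi> u) \<le> K * (u / w) powr - (\<beta> + 1)" .
      qed (use \<beta> t w K in auto)
      also have "\<dots> \<le> ennreal (D * m powr \<beta> * z powr \<beta>)"
        using powr_mono2[OF _ _ wm, of \<beta>] w D \<beta> m 1
        by (intro ennreal_leI) (simp add: powr_mult)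
      also have "\<dots> = ennreal (D * m powr \<beta>) * ennreal_powr (bernstein_inv \<phi> (1 / t)) \<beta>"
        using ennreal_powr_bernstein_inv[OF 1(1), of \<beta>] 1 D by (simp add: ennreal_mult)
      finally show ?thesis .
    next
      \<comment> \<open>At an unattained level the right-hand side is infinite, the constant being
        positive.\<close>
      case 2
      then show ?thesis using D m by (simp add: ennreal_powr_def ennreal_mult_top)
    qed
  qed
  thus ?thesis using D m by (intro exI[of _ "D * m powr \<beta>"]) auto
qed

text \<open>Scaling near 0 governs only \<open>u \<le> s0\<close>. Beyond \<open>s0\<close> the
  exponential is split into two equal factors: one yields the power of \<open>z\<close>, the other,
  by logarithmic growth, the decay in \<open>u\<close>.\<close>

lemma neg_moment_le_large_time:
  assumes \<beta>: "\<beta> > 0"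
    and L1: "Liminf at_top (\<lambda>s. ereal (\<phi> s / ln s)) > 0"
    and r: "r > 1" and L0: "Liminf (at_right 0) (\<lambda>s. ereal (\<phi> (r * s) / \<phi> s)) > 1"
  shows "\<exists>C>0. \<forall>\<^sub>F t in at_top.
           neg_moment M (S t) \<beta> \<le> ennreal C * ennreal_powr (bernstein_inv \<phi> (1 / t)) \<beta>"
proof -
  define q where "q = \<beta> + 1"
  have q: "q > 0" using \<beta> by (simp add: q_def)
  obtain c where c: "c > 0" "eventually (\<lambda>s. \<phi> s / ln s > c) at_top"
    using Liminf_ereal_gt_obtain[OF L1[unfolded zero_ereal_def]] .
  then obtain s1' where s1': "\<And>s. s \<ge> s1' \<Longrightarrow> \<phi> s / ln s > c"
    by (auto simp: eventually_at_top_linorder)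
  \<comment> \<open>The maximum with 2 keeps \<open>ln s\<close> positive, so that the quotient
    bound can be multiplied out.\<close>
  define s1 where "s1 = max s1' 2"
  have s1: "s1 > 1" by (simp add: s1_def)
  have log_bound: "c * ln s \<le> \<phi> s" if "s \<ge> s1" for s
    using s1'[of s] that by (auto simp: s1_def field_simps)
  obtain \<kappa> where \<kappa>: "\<kappa> > 1" "eventually (\<lambda>s. \<phi> (r * s) / \<phi> s > \<kappa>) (at_right 0)"
    using Liminf_ereal_gt_obtain[OF L0[unfolded one_ereal_def]] .
  then obtain s0' where s0': "s0' > 0" "\<And>s. 0 < s \<Longrightarrow> s < s0' \<Longrightarrow> \<phi> (r * s) / \<phi> s > \<kappa>"
    by (auto simp: eventually_at_right_field)
  define s0 where "s0 = min s0' 1"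
  have s0: "s0 > 0" "s0 \<le> 1" using s0' by (auto simp: s0_def)
  have step: "\<kappa> * \<phi> s \<le> \<phi> (r * s)" if "0 < s" "s < s0" for s
    using s0'(2)[of s] that pos[of s] by (auto simp: s0_def field_simps)
  define p where "p = log r \<kappa>"
  have p: "p > 0" using r \<kappa> by (simp add: p_def)
  \<comment> \<open>The 2 in \<open>1 / (2 * \<kappa>)\<close> is there because beyond
    \<open>s0\<close> only half of the exponent goes into this bound.\<close>
  obtain K where K: "K > 0" "\<And>v. v > 0 \<Longrightarrow> exp (- (1 / (2 * \<kappa>) * v powr p)) \<le> K * v powr - q"
    using exp_minus_powr_le[of "1 / (2 * \<kappa>)" p q] p \<kappa> q by auto
  \<comment> \<open>Takes up the ratio of \<open>s1\<close> to \<open>s0\<close> that is left when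
    the two factors are multiplied.\<close>
  define K' where "K' = K * (s1 / s0) powr q"
  have K': "K \<le> K'" "K' > 0"
    using K q s0 s1 ge_one_powr_ge_zero[of "s1 / s0" q] by (auto simp: K'_def)
  define D where "D = (1 / \<beta> + K') / Gamma \<beta>"
  have D: "D > 0" using \<beta> K' by (auto simp: D_def Gamma_real_pos add_pos_pos)
  \<comment> \<open>The first term ensures \<open>1 / t \<le> \<phi> s0\<close>, hence a preimage
    \<open>z \<le> s0\<close>; the second ensures \<open>t / 2 * c \<ge> q\<close>.\<close>
  define t0 where "t0 = max (1 / \<phi> s0) (2 * q / c)"
  have "neg_moment M (S t) \<beta> \<le> ennreal D * ennreal_powr (bernstein_inv \<phi> (1 / t)) \<beta>"
    if t: "t \<ge> t0" for t
  proof -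
    have "1 / \<phi> s0 > 0" using pos s0 by simp
    moreover have "1 / \<phi> s0 \<le> t" "2 * q / c \<le> t" using t by (auto simp: t0_def)
    ultimately have t': "t > 0" "1 / \<phi> s0 \<le> t" "2 * q / c \<le> t" by linarith+
    hence "0 < 1 / t" "1 / t \<le> \<phi> s0" using pos[OF s0(1)] by (auto simp: field_simps)
    then obtain z where z: "z > 0" "z \<le> s0" "\<phi> z = 1 / t"
      using exponent_surj[of "1 / t" s0] s0 by auto
    have near: "1 / \<kappa> * (u / z) powr p \<le> t * \<phi> u" if u: "z \<le> u" "u \<le> s0" for u
    proof -
      have "(u / z) powr p / \<kappa> * \<phi> z \<le> \<phi> u"
        unfolding p_def
      proof (rule scaling_imp_powr_bound)
        fix s assume s: "z \<le> s" "r * s \<le> u"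
        \<comment> \<open>The scaling bound is available strictly below \<open>s0\<close>; the
          strictness comes from \<open>r > 1\<close>.\<close>
        have "1 * s < r * s" using r s z by (intro mult_strict_right_mono) auto
        hence "s < s0" using s u by linarith
        thus "\<kappa> * \<phi> s \<le> \<phi> (r * s)" using s u z by (intro step) auto
      qed (use u z r \<kappa> exponent_mono pos[OF z(1)] in auto)
      hence "t * ((u / z) powr p / \<kappa> * \<phi> z) \<le> t * \<phi> u"
        using t' by (intro mult_left_mono) auto
      hence "(u / z) powr p / \<kappa> * (t * \<phi> z) \<le> t * \<phi> u"
        by (simp only: mult_ac)
      thus ?thesis using z t' by simp
    qed
    have "neg_moment M (S t) \<beta> \<le> ennreal (D * z powr \<beta>)"
      unfolding D_def
    proof (rule neg_moment_le)
      fix u assume u: "z \<le> u"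
      have v: "u / z > 0" using u z by simp
      have "exp (- t * \<phi> u) \<le> K' * (u / z) powr - q"
      proof (cases "u \<le> s0")
        case True
        have "1 / (2 * \<kappa>) * (u / z) powr p \<le> 1 / \<kappa> * (u / z) powr p"
          using \<kappa> by (intro mult_right_mono) (auto simp: field_simps)
        hence "exp (- t * \<phi> u) \<le> exp (- (1 / (2 * \<kappa>) * (u / z) powr p))"
          using near[OF u True] by simp
        also have "\<dots> \<le> K * (u / z) powr - q" by (rule K(2)[OF v])
        also have "\<dots> \<le> K' * (u / z) powr - q" using K' by (intro mult_right_mono) auto
        finally show ?thesis .
      next
        case False
        hence us: "s0 \<le> u" "u > 0" using s0 by auto
        \<comment> \<open>By monotonicity the first factor is controlled by its value at
          \<open>s0\<close>, where \<open>near\<close> still applies.\<close>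
        have "1 / (2 * \<kappa>) * (s0 / z) powr p \<le> t / 2 * \<phi> s0"
          using near[of s0] z by simp
        also have "\<dots> \<le> t / 2 * \<phi> u"
          using exponent_mono[OF s0(1) us(1)] t' by (intro mult_left_mono) auto
        finally have "exp (- (t / 2 * \<phi> u)) \<le> exp (- (1 / (2 * \<kappa>) * (s0 / z) powr p))" by simp
        also have "\<dots> \<le> K * (s0 / z) powr - q" using s0 z by (intro K(2)) auto
        finally have half1: "exp (- (t / 2 * \<phi> u)) \<le> K * (s0 / z) powr - q" .
        have half2: "exp (- (t / 2 * \<phi> u)) \<le> (u / s1) powr - q"
        proof (cases "u \<le> s1")
          case True
          \<comment> \<open>Up to \<open>s1\<close> no logarithmic growth is at hand, but there the
            right-hand side is at least 1.\<close>
          have "exp (- (t / 2 * \<phi> u)) \<le> 1" using t' pos[OF us(2)] by simp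
          also have "1 = 1 powr - q" by simp
          also have "\<dots> \<le> (u / s1) powr - q"
            using True us s1 q by (intro powr_mono2') auto
          finally show ?thesis .
        next
          case False
          have "q * ln u = (2 * q / c) / 2 * (c * ln u)" using c by simp
          also have "\<dots> \<le> t / 2 * \<phi> u"
          proof (rule mult_mono)
            show "2 * q / c / 2 \<le> t / 2" using t'(3) by (intro divide_right_mono) auto
            show "c * ln u \<le> \<phi> u" using log_bound[of u] False by simp
          qed (use t' c False s1 in auto)
          finally have "exp (- (t / 2 * \<phi> u)) \<le> u powr - q"
            using us by (simp add: powr_def)
          also have "\<dots> \<le> (u / s1) powr - q"
            using us s1 q by (intro powr_mono2') (auto simp: field_simps)
          finally show ?thesis .
        qed
        have "exp (- t * \<phi> u) = exp (- (t / 2 * \<phi> u)) * exp (- (t / 2 * \<phi> u))"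
          by (simp flip: exp_add)
        also have "\<dots> \<le> (K * (s0 / z) powr - q) * (u / s1) powr - q"
          by (intro mult_mono half1 half2) (use K in auto)
        also have "\<dots> = K' * (u / z) powr - q"
          using s0 s1 z us unfolding K'_def powr_minus
          by (simp add: powr_divide field_simps)
        finally show ?thesis .
      qed
      thus "exp (- t * \<phi> u) \<le> K' * (u / z) powr - (\<beta> + 1)" by (simp only: q_def)
    qed (use \<beta> t' z K' in auto)
    also have "\<dots> = ennreal D * ennreal_powr (bernstein_inv \<phi> (1 / t)) \<beta>"
      using ennreal_powr_bernstein_inv[OF z(1), of \<beta>] z D by (simp add: ennreal_mult)
    finally show ?thesis .
  qed
  hence "\<forall>\<^sub>F t in at_top. neg_moment M (S t) \<beta> \<le> ennreal D * ennreal_powr (bernstein_inv \<phi> (1 / t)) \<beta>"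
    by (auto simp: eventually_at_top_linorder)
  thus ?thesis using D by blast
qed

text \<open>One summand for each term of the splitting at \<open>k\<close>, hence the factor 2,
  which is absorbed for large \<open>t\<close> in the theorem.\<close>

lemma expectation_exp_powr_le:
  assumes lower: "\<And>u. u > 0 \<Longrightarrow> a * u powr \<alpha> \<le> \<phi> u"
    and \<alpha>: "0 < \<alpha>" and \<theta>: "\<theta> > 0" and \<delta>: "0 < \<delta>" "\<delta> \<le> 1" and t: "t > 0"
  shows "expectation (\<lambda>\<omega>. exp (- \<theta> * (S t \<omega> powr \<delta>)))
    \<le> 2 * exp (- min (a * \<theta> powr \<alpha>) \<theta> * t powr (\<delta> / (\<alpha> * (1 - \<delta>) + \<delta>)))"
proof -
  define \<eta> where "\<eta> = \<alpha> * (1 - \<delta>) + \<delta>"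
  have \<eta>: "\<eta> > 0" using \<alpha> \<delta> by (simp add: \<eta>_def add_nonneg_pos)
  \<comment> \<open>Balances the terms: \<open>t * (k powr (\<delta> - 1)) powr \<alpha>\<close> and
    \<open>k powr \<delta>\<close> both equal \<open>t powr (\<delta> / \<eta>)\<close>.\<close>
  define k where "k = t powr (1 / \<eta>)"
  have k: "k > 0" using t by (simp add: k_def)
  have k_delta: "k powr \<delta> = t powr (\<delta> / \<eta>)"
    by (simp add: k_def powr_powr)
  have "t * (k powr (\<delta> - 1)) powr \<alpha> = t powr (1 + (\<delta> - 1) * \<alpha> / \<eta>)"
    using t by (simp add: k_def powr_powr powr_add)
  also have "1 + (\<delta> - 1) * \<alpha> / \<eta> = (\<eta> + (\<delta> - 1) * \<alpha>) / \<eta>" using \<eta> by (simp add: field_simps)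
  also have "\<eta> + (\<delta> - 1) * \<alpha> = \<delta>" by (simp add: \<eta>_def algebra_simps)
  finally have k_alpha: "t * (k powr (\<delta> - 1)) powr \<alpha> = t powr (\<delta> / \<eta>)" .
  define m where "m = min (a * \<theta> powr \<alpha>) \<theta>"
  have [measurable]: "S t \<in> borel_measurable M" using t by simp
  let ?u = "\<theta> * k powr (\<delta> - 1)"
  have u: "?u > 0" using \<theta> k by simp
  have "expectation (\<lambda>\<omega>. exp (- \<theta> * (S t \<omega> powr \<delta>)))
      \<le> expectation (\<lambda>\<omega>. exp (- ?u * S t \<omega>) + exp (- \<theta> * k powr \<delta>))"
  proof (rule integral_mono_AE)
    show "integrable M (\<lambda>\<omega>. exp (- \<theta> * (S t \<omega> powr \<delta>)))"
      using \<theta> by (intro integrable_const_bound[where B = 1]) auto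
    show "integrable M (\<lambda>\<omega>. exp (- ?u * S t \<omega>) + exp (- \<theta> * k powr \<delta>))"
      using t u by (intro Bochner_Integration.integrable_add integrable_exp) auto
    show "AE \<omega> in M. exp (- \<theta> * (S t \<omega> powr \<delta>)) \<le> exp (- ?u * S t \<omega>) + exp (- \<theta> * k powr \<delta>)"
      using nonneg[OF less_imp_le[OF t]]
    proof eventually_elim
      fix \<omega> assume x: "0 \<le> S t \<omega>"
      show "exp (- \<theta> * (S t \<omega> powr \<delta>)) \<le> exp (- ?u * S t \<omega>) + exp (- \<theta> * k powr \<delta>)"
      proof (cases "S t \<omega> \<le> k")
        case True
        \<comment> \<open>As \<open>\<delta> \<le> 1\<close>, \<open>x powr (\<delta> - 1)\<close>
          is nonincreasing for \<open>x > 0\<close>, so below \<open>k\<close> the power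
          \<open>x powr \<delta>\<close> lies above the chord through 0 and
          \<open>k\<close>.\<close>
        have "k powr (\<delta> - 1) * S t \<omega> \<le> S t \<omega> powr \<delta>"
        proof (cases "S t \<omega> = 0")
          case False
          hence "k powr (\<delta> - 1) * S t \<omega> \<le> S t \<omega> powr (\<delta> - 1) * S t \<omega> powr 1"
            using True x k \<delta> powr_mono2'[of "1 - \<delta>" "S t \<omega>" k]
            by (auto intro!: mult_mono powr_mono2')
          thus ?thesis by (simp only: powr_add[symmetric]) simp
        qed simp
        hence "exp (- \<theta> * (S t \<omega> powr \<delta>)) \<le> exp (- ?u * S t \<omega>)"
          using \<theta> by (simp add: mult.assoc)
        thus ?thesis by (rule order_trans) simp
      next
        case False
        hence "k powr \<delta> \<le> S t \<omega> powr \<delta>" using k \<delta> by (intro powr_mono2) auto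
        hence "exp (- \<theta> * (S t \<omega> powr \<delta>)) \<le> exp (- \<theta> * k powr \<delta>)" using \<theta> by simp
        thus ?thesis by (rule order_trans) simp
      qed
    qed
  qed
  also have "\<dots> = exp (- t * \<phi> ?u) + exp (- \<theta> * k powr \<delta>)"
    using t u laplace[of ?u t] integrable_exp[of ?u t] by (simp add: prob_space)
  also have "exp (- t * \<phi> ?u) \<le> exp (- m * t powr (\<delta> / \<eta>))"
  proof -
    have "m * t powr (\<delta> / \<eta>) \<le> (a * \<theta> powr \<alpha>) * t powr (\<delta> / \<eta>)"
      by (intro mult_right_mono) (auto simp: m_def)
    also have "\<dots> = t * (a * ?u powr \<alpha>)"
      using \<theta> k by (simp add: powr_mult flip: k_alpha)
    also have "\<dots> \<le> t * \<phi> ?u" using t lower[OF u] by (intro mult_left_mono) auto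
    finally show ?thesis by simp
  qed
  also have "exp (- \<theta> * k powr \<delta>) \<le> exp (- m * t powr (\<delta> / \<eta>))"
    unfolding k_delta by (auto simp: m_def intro: mult_right_mono)
  finally show ?thesis by (simp add: m_def \<eta>_def)
qed

text \<open>\<open>K\<close> is a parameter tied only to \<open>a\<close>, \<open>\<alpha>\<close>
  and \<open>\<gamma>\<close>, so that the constant is the same for all processes with this lower
  bound on \<open>\<phi>\<close>.\<close>

lemma neg_log_moment_le:
  assumes lower: "\<And>u. u > 0 \<Longrightarrow> a * u powr \<alpha> \<le> \<phi> u"
    and K: "K > 0" "\<And>v. v > 0 \<Longrightarrow> exp (- (a * v powr \<alpha>)) \<le> K * v powr - (\<gamma> + 1)"
    and \<alpha>: "0 < \<alpha>" and \<gamma>: "\<gamma> > 0" and t: "t > 0"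
  shows "neg_log_moment M (S t) \<gamma>
    \<le> ennreal ((1 + (1 / \<gamma> + K) / Gamma \<gamma>) * ln (1 + t powr (1 / \<alpha>)) powr - \<gamma>)"
proof -
  define T where "T = t powr (1 / \<alpha>)"
  have T: "T > 0" "T powr \<alpha> = t" using t \<alpha> by (auto simp: T_def powr_powr)
  define l where "l = ln (1 + T)"
  have l: "l > 0" using T by (simp add: l_def)
  define D where "D = (1 / \<gamma> + K) / Gamma \<gamma>"
  have D: "D > 0" using \<gamma> K by (auto simp: D_def Gamma_real_pos add_pos_pos)
  have [measurable]: "S t \<in> borel_measurable M" using t by simp
  \<comment> \<open>The scale is \<open>1 / T\<close>: as \<open>T powr \<alpha> = t\<close>, the
    product \<open>t * (a * u powr \<alpha>)\<close> is
    \<open>a * (u * T) powr \<alpha>\<close>.\<close>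
  have "neg_moment M (S t) \<gamma> \<le> ennreal (D * (1 / T) powr \<gamma>)"
    unfolding D_def
  proof (rule neg_moment_le)
    fix u assume u: "1 / T \<le> u"
    have u0: "u > 0" using u T by (meson divide_pos_pos less_le_trans zero_less_one)
    have "a * (u / (1 / T)) powr \<alpha> = t * (a * u powr \<alpha>)"
      using T u0 by (simp add: powr_mult)
    also have "\<dots> \<le> t * \<phi> u" using t lower[OF u0] by (intro mult_left_mono) auto
    finally have "exp (- t * \<phi> u) \<le> exp (- (a * (u / (1 / T)) powr \<alpha>))" by simp
    also have "\<dots> \<le> K * (u / (1 / T)) powr - (\<gamma> + 1)" using u0 T by (intro K) auto
    finally show "exp (- t * \<phi> u) \<le> K * (u / (1 / T)) powr - (\<gamma> + 1)" .
  qed (use \<gamma> t T K in auto)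
  hence "ennreal (T powr \<gamma>) * neg_moment M (S t) \<gamma> \<le> ennreal (T powr \<gamma>) * ennreal (D * (1 / T) powr \<gamma>)"
    by (rule mult_left_mono) simp
  also have "\<dots> = ennreal D"
    using T D by (simp add: powr_divide flip: ennreal_mult)
  finally have mom: "ennreal (T powr \<gamma>) * neg_moment M (S t) \<gamma> \<le> ennreal D" .
  have "neg_log_moment M (S t) \<gamma> \<le>
      (\<integral>\<^sup>+\<omega>. ennreal (l powr - \<gamma>) * (1 + ennreal (T powr \<gamma>) * inverse (ennreal (S t \<omega> powr \<gamma>))) \<partial>M)"
    unfolding neg_log_moment_def neg_moment_def
  proof (rule nn_integral_mono_AE)
    show "AE \<omega> in M. inverse (ennreal (ln (1 + S t \<omega>) powr \<gamma>))
        \<le> ennreal (l powr - \<gamma>) * (1 + ennreal (T powr \<gamma>) * inverse (ennreal (S t \<omega> powr \<gamma>)))"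
      using nonneg[OF less_imp_le[OF t]]
    proof eventually_elim
      fix \<omega> assume x: "0 \<le> S t \<omega>"
      show "inverse (ennreal (ln (1 + S t \<omega>) powr \<gamma>))
        \<le> ennreal (l powr - \<gamma>) * (1 + ennreal (T powr \<gamma>) * inverse (ennreal (S t \<omega> powr \<gamma>)))"
      proof (cases "S t \<omega> = 0")
        case True
        then show ?thesis using T l by (simp add: ennreal_mult_top)
      next
        case False
        define R where "R = S t \<omega> / T"
        have R: "R > 0" "S t \<omega> = T * R" using False x T by (auto simp: R_def)
        have ln_pos: "ln (1 + T * R) > 0" using R T by (intro ln_gt_zero) simp
        \<comment> \<open>The summand \<open>1\<close> covers \<open>R > 1\<close>, by monotonicity
          of \<open>ln\<close>; the summand \<open>R powr - \<gamma>\<close> covers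
          \<open>R \<le> 1\<close>, by concavity.\<close>
        have "ln (1 + T * R) powr - \<gamma> \<le> l powr - \<gamma> * (1 + R powr - \<gamma>)"
        proof (cases "R \<le> 1")
          case True
          have "ln (1 + T * R) powr - \<gamma> \<le> (R * l) powr - \<gamma>"
            using ln_one_plus_mult_ge[of R T] R T True \<gamma> l unfolding l_def
            by (intro powr_mono2') auto
          also have "\<dots> = l powr - \<gamma> * R powr - \<gamma>" using R l by (simp add: powr_mult)
          also have "\<dots> \<le> l powr - \<gamma> * (1 + R powr - \<gamma>)" by (intro mult_left_mono) auto
          finally show ?thesis .
        next
          case False
          have "ln (1 + T * R) powr - \<gamma> \<le> l powr - \<gamma>"
            using False T \<gamma> l R unfolding l_def by (intro powr_mono2' ln_mono) auto
          also have "\<dots> \<le> l powr - \<gamma> * (1 + R powr - \<gamma>)" by (simp add: algebra_simps)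
          finally show ?thesis .
        qed
        also have "R powr - \<gamma> = T powr \<gamma> * (S t \<omega>) powr - \<gamma>"
          using R T by (simp add: powr_mult powr_minus)
        finally have "ennreal (ln (1 + S t \<omega>) powr - \<gamma>) \<le>
            ennreal (l powr - \<gamma> * (1 + T powr \<gamma> * S t \<omega> powr - \<gamma>))"
          by (intro ennreal_leI) (simp add: R)
        thus ?thesis
          using R T ln_pos by (simp add: inverse_ennreal powr_minus ennreal_mult)
      qed
    qed
  qed
  also have "\<dots> = ennreal (l powr - \<gamma>) * (1 + ennreal (T powr \<gamma>) * neg_moment M (S t) \<gamma>)"
    unfolding neg_moment_def by (simp add: nn_integral_cmult nn_integral_add emeasure_space_1)
  also have "\<dots> \<le> ennreal (l powr - \<gamma>) * (1 + ennreal D)"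
    using mom by (intro mult_left_mono add_left_mono) auto
  also have "\<dots> = ennreal ((1 + D) * l powr - \<gamma>)"
    using D by (simp add: ennreal_mult mult.commute)
  finally show ?thesis by (simp add: D_def l_def T_def)
qed

text \<open>With \<open>R = S t / T\<close>, raising
  \<open>ln (1 + S t) \<le> exp R * ln (1 + T)\<close> to the power \<open>- \<gamma>\<close> leaves
  \<open>exp (- \<gamma> * R)\<close>, whose mean is the Laplace transform at
  \<open>\<gamma> / T\<close>. \<open>T\<close> is tied to \<open>t\<close> only in the stable
  case.\<close>

lemma neg_log_moment_ge:
  assumes \<gamma>: "\<gamma> > 0" and T: "T > 0" and t: "t \<ge> 0"
  shows "ennreal (exp (- t * \<phi> (\<gamma> / T)) * ln (1 + T) powr - \<gamma>) \<le> neg_log_moment M (S t) \<gamma>"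
proof -
  define l where "l = ln (1 + T)"
  have l: "l > 0" using T by (simp add: l_def)
  have [measurable]: "S t \<in> borel_measurable M" using t by simp
  have "ennreal (exp (- t * \<phi> (\<gamma> / T)) * l powr - \<gamma>)
      = ennreal (expectation (\<lambda>\<omega>. exp (- (\<gamma> / T) * S t \<omega>) * l powr - \<gamma>))"
    using laplace[of "\<gamma> / T" t] T \<gamma> t by simp
  also have "\<dots> = (\<integral>\<^sup>+\<omega>. ennreal (exp (- (\<gamma> / T) * S t \<omega>) * l powr - \<gamma>) \<partial>M)"
    using integrable_exp[of "\<gamma> / T" t] T \<gamma> t by (intro nn_integral_eq_integral[symmetric]) auto
  also have "\<dots> \<le> neg_log_moment M (S t) \<gamma>"
    unfolding neg_log_moment_def neg_moment_def
  proof (rule nn_integral_mono_AE)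
    show "AE \<omega> in M. ennreal (exp (- (\<gamma> / T) * S t \<omega>) * l powr - \<gamma>)
        \<le> inverse (ennreal (ln (1 + S t \<omega>) powr \<gamma>))"
      using nonneg[OF t]
    proof eventually_elim
      fix \<omega> assume x: "0 \<le> S t \<omega>"
      show "ennreal (exp (- (\<gamma> / T) * S t \<omega>) * l powr - \<gamma>)
        \<le> inverse (ennreal (ln (1 + S t \<omega>) powr \<gamma>))"
      proof (cases "S t \<omega> = 0")
        case False
        define R where "R = S t \<omega> / T"
        have R: "R > 0" "S t \<omega> = T * R" using False x T by (auto simp: R_def)
        have ln_pos: "ln (1 + T * R) > 0" using R T by (intro ln_gt_zero) simp
        have "ln (1 + T * R) \<le> (1 + R) * l"
          using ln_one_plus_mult_le[of R T] R T by (simp add: l_def)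
        also have "\<dots> \<le> exp R * l"
          using l by (intro mult_right_mono) auto
        finally have "(exp R * l) powr - \<gamma> \<le> ln (1 + T * R) powr - \<gamma>"
          using ln_pos \<gamma> by (intro powr_mono2') auto
        moreover have "(exp R * l) powr - \<gamma> = exp (- (\<gamma> / T) * S t \<omega>) * l powr - \<gamma>"
          using R T l by (simp add: powr_mult) (simp add: powr_def)
        ultimately show ?thesis
          using R ln_pos by (simp add: inverse_ennreal ennreal_leI flip: powr_minus)
      qed simp
    qed
  qed
  finally show ?thesis by (simp add: l_def)
qed

end

subsection \<open>Stable Levy measures\<close>

text \<open>Compares the Levy-Khintchine integrand with \<open>min y 1\<close>, the function
  integrated in \<open>levy_measure\<close>.\<close>

lemma one_minus_exp_le:
  fixes u y :: real
  assumes "u > 0" "y > 0"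
  shows "1 - exp (- u * y) \<le> max 1 u * min y 1"
proof (cases "y \<le> 1")
  case True
  have "1 - exp (- u * y) \<le> u * y" using exp_ge_add_one_self[of "- u * y"] by simp
  also have "\<dots> \<le> max 1 u * y" using assms by (intro mult_right_mono) auto
  finally show ?thesis using True by simp
next
  case False
  have "1 - exp (- u * y) \<le> 1" by simp
  also have "\<dots> \<le> max 1 u * min y 1" using False by simp
  finally show ?thesis .
qed

lemma levy_measure_integrable_one_minus_exp:
  assumes "levy_measure \<nu>" "u > 0"
  shows "set_integrable \<nu> {0<..} (\<lambda>y. 1 - exp (- u * y))"
proof -
  have sets [measurable_cong]: "sets \<nu> = sets borel"
    and fin: "(\<integral>\<^sup>+y\<in>{0<..}. ennreal (min y 1) \<partial>\<nu>) < \<infinity>"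
    using assms by (auto simp: levy_measure_def)
  have "(\<integral>\<^sup>+y. ennreal (norm (indicator {0<..} y *\<^sub>R (1 - exp (- u * y)))) \<partial>\<nu>)
      \<le> (\<integral>\<^sup>+y. ennreal (max 1 u) * (ennreal (min y 1) * indicator {0<..} y) \<partial>\<nu>)"
  proof (intro nn_integral_mono)
    fix y :: real
    show "ennreal (norm (indicator {0<..} y *\<^sub>R (1 - exp (- u * y))))
        \<le> ennreal (max 1 u) * (ennreal (min y 1) * indicator {0<..} y)"
      using one_minus_exp_le[OF assms(2), of y] assms(2)
      by (cases "y > 0") (auto simp flip: ennreal_mult intro!: ennreal_leI)
  qed
  also have "\<dots> = ennreal (max 1 u) * (\<integral>\<^sup>+y\<in>{0<..}. ennreal (min y 1) \<partial>\<nu>)"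
    by (rule nn_integral_cmult) measurable
  also have "\<dots> < \<infinity>" using fin by (simp add: ennreal_mult_less_top)
  finally show ?thesis
    unfolding set_integrable_def by (intro integrableI_bounded) simp_all
qed

text \<open>The interval has length \<open>1 / u\<close>, and the decreasing density is at least its
  value at the right endpoint \<open>2 / u\<close>.\<close>

lemma emeasure_stable_measure_ge:
  assumes "c > 0" "\<alpha> > 0" "u > 0"
  shows "emeasure (stable_measure c \<alpha>) {1 / u..2 / u} \<ge> ennreal (c * 2 powr (- 1 - \<alpha>) * u powr \<alpha>)"
proof -
  have "u powr \<alpha> = u powr (1 + \<alpha>) * (1 / u)" using assms by (simp add: powr_add)
  hence "ennreal (c * 2 powr (- 1 - \<alpha>) * u powr \<alpha>) = ennreal (c * (2 / u) powr (- 1 - \<alpha>)) * ennreal (1 / u)"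
    using assms by (subst ennreal_mult[symmetric])
      (simp_all add: powr_divide powr_minus_divide[of u "1 + \<alpha>", simplified])
  also have "ennreal (1 / u) = emeasure lborel {1 / u..2 / u}"
    using assms by (simp add: diff_divide_distrib[symmetric] divide_right_mono)
  also have "ennreal (c * (2 / u) powr (- 1 - \<alpha>)) * emeasure lborel {1 / u..2 / u}
      = (\<integral>\<^sup>+y. ennreal (c * (2 / u) powr (- 1 - \<alpha>)) * indicator {1 / u..2 / u} y \<partial>lborel)"
    by (simp add: nn_integral_cmult)
  also have "\<dots> \<le> (\<integral>\<^sup>+y. (ennreal (c * y powr (- 1 - \<alpha>)) * indicator {0<..} y) * indicator {1 / u..2 / u} y \<partial>lborel)"
  proof (intro nn_integral_mono)
    fix y :: real
    show "ennreal (c * (2 / u) powr (- 1 - \<alpha>)) * indicator {1 / u..2 / u} y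
      \<le> (ennreal (c * y powr (- 1 - \<alpha>)) * indicator {0<..} y) * indicator {1 / u..2 / u} y"
    proof (cases "y \<in> {1 / u..2 / u}")
      case True
      have "1 / u > 0" using assms by simp
      hence "y > 0" using True unfolding atLeastAtMost_iff by linarith
      thus ?thesis using True assms
        by (auto intro!: ennreal_leI mult_left_mono powr_mono2')
    qed simp
  qed
  also have "\<dots> = emeasure (stable_measure c \<alpha>) {1 / u..2 / u}"
    unfolding stable_measure_def by (rule emeasure_density[symmetric]) measurable
  finally show ?thesis .
qed

text \<open>Drift and jumps outside \<open>{1 / u..2 / u}\<close> contribute nonnegatively; on this
  interval \<open>u * y \<ge> 1\<close>, so the integrand is at least
  \<open>1 - exp (- 1)\<close>.\<close>

lemma levy_khintchine_ge_powr:
  assumes lk: "levy_khintchine \<phi> b \<nu>" and dom: "dominates \<nu> (stable_measure c \<alpha>)"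
    and "c > 0" "\<alpha> > 0" "u > 0"
  shows "(1 - exp (- 1)) * (c * 2 powr (- 1 - \<alpha>)) * u powr \<alpha> \<le> \<phi> u"
proof -
  have lm: "levy_measure \<nu>" and b: "b \<ge> 0"
    and \<phi>: "\<phi> u = b * u + (LINT y:{0<..}|\<nu>. 1 - exp (- u * y))"
    using lk assms by (auto simp: levy_khintchine_def)
  have sets [measurable_cong]: "sets \<nu> = sets borel" using lm by (simp add: levy_measure_def)
  let ?f = "\<lambda>y. indicator {0<..} y *\<^sub>R (1 - exp (- u * y))"
  let ?A = "{1 / u..2 / u}"
  have e: "1 - exp (- 1) \<ge> (0::real)" by simp
  have f0: "?f y \<ge> 0" for y using assms by (auto simp: indicator_def)
  have "ennreal ((1 - exp (- 1)) * (c * 2 powr (- 1 - \<alpha>)) * u powr \<alpha>)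
      = ennreal (1 - exp (- 1)) * ennreal (c * 2 powr (- 1 - \<alpha>) * u powr \<alpha>)"
    using assms e by (subst ennreal_mult[symmetric]) (simp_all add: mult.assoc)
  also have "\<dots> \<le> ennreal (1 - exp (- 1)) * emeasure (stable_measure c \<alpha>) ?A"
    using assms by (intro mult_left_mono emeasure_stable_measure_ge) auto
  also have "\<dots> \<le> ennreal (1 - exp (- 1)) * emeasure \<nu> ?A"
    using dom by (intro mult_left_mono) (auto simp: dominates_def)
  also have "\<dots> = (\<integral>\<^sup>+y. ennreal (1 - exp (- 1)) * indicator ?A y \<partial>\<nu>)"
    by (simp add: nn_integral_cmult_indicator)
  also have "\<dots> \<le> (\<integral>\<^sup>+y. ennreal (?f y) \<partial>\<nu>)"
  proof (intro nn_integral_mono)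
    fix y :: real
    show "ennreal (1 - exp (- 1)) * indicator ?A y \<le> ennreal (?f y)"
    proof (cases "y \<in> ?A")
      case True
      have "1 / u > 0" using assms by simp
      hence "y > 0" using True unfolding atLeastAtMost_iff by linarith
      moreover have "1 \<le> u * y" using True assms by (simp add: field_simps)
      ultimately show ?thesis using True by (auto intro!: ennreal_leI)
    qed simp
  qed
  also have "\<dots> = ennreal (LINT y|\<nu>. ?f y)"
    using levy_measure_integrable_one_minus_exp[OF lm \<open>u > 0\<close>] f0
    by (intro nn_integral_eq_integral) (auto simp: set_integrable_def)
  finally have "(1 - exp (- 1)) * (c * 2 powr (- 1 - \<alpha>)) * u powr \<alpha> \<le> (LINT y|\<nu>. ?f y)"
    using f0 by (subst (asm) ennreal_le_iff) (auto intro: integral_nonneg)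
  thus ?thesis using b assms by (simp add: \<phi> set_lebesgue_integral_def add_increasing)
qed

text \<open>Substituting \<open>y / u\<close> shows that the driftless stable exponent is
  homogeneous of degree \<open>\<alpha>\<close>; the integral is its value at 1.\<close>

lemma levy_khintchine_stable:
  assumes lk: "levy_khintchine \<phi> 0 (stable_measure c \<alpha>)" and "c > 0" and u: "u > 0"
  shows "\<phi> u = u powr \<alpha> * (LINT y:{0<..}|stable_measure c \<alpha>. 1 - exp (- y))"
proof -
  define h where "h v y = indicator {0<..} y * (c * y powr (- 1 - \<alpha>)) * (1 - exp (- v * y))" for v y :: real
  have F: "(LINT y:{0<..}|stable_measure c \<alpha>. 1 - exp (- v * y)) = (LINT y|lborel. h v y)" for v
  proof -
    have *: "stable_measure c \<alpha> = density lborel (\<lambda>y. ennreal (c * y powr (- 1 - \<alpha>) * indicator {0<..} y))"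
      unfolding stable_measure_def
      by (intro density_cong) (auto simp: indicator_def)
    show ?thesis
      unfolding * set_lebesgue_integral_def using \<open>c > 0\<close>
      by (subst integral_density) (auto simp: h_def indicator_def intro!: Bochner_Integration.integral_cong)
  qed
  have "(LINT y|lborel. h u y) = \<bar>1 / u\<bar> *\<^sub>R (LINT y|lborel. h u (0 + 1 / u * y))"
    using u by (intro lborel_integral_real_affine) simp
  also have "(LINT y|lborel. h u (0 + 1 / u * y)) = (LINT y|lborel. u powr (1 + \<alpha>) * h 1 y)"
  proof (intro Bochner_Integration.integral_cong refl)
    fix y :: real
    show "h u (0 + 1 / u * y) = u powr (1 + \<alpha>) * h 1 y"
    proof (cases "y > 0")
      case True
      have "(y / u) powr (- 1 - \<alpha>) = y powr (- 1 - \<alpha>) * u powr (1 + \<alpha>)"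
        using True u powr_minus[of u "1 + \<alpha>"] by (simp add: powr_divide) (simp add: divide_inverse)
      thus ?thesis using True u by (simp add: h_def)
    qed (use u in \<open>auto simp: h_def indicator_def field_simps\<close>)
  qed
  also have "\<bar>1 / u\<bar> *\<^sub>R (LINT y|lborel. u powr (1 + \<alpha>) * h 1 y) = u powr \<alpha> * (LINT y|lborel. h 1 y)"
    using u by (simp add: powr_add)
  finally show ?thesis
    using lk u F[of u] F[of 1] by (simp add: levy_khintchine_def)
qed

section \<open>Application to subordinators\<close>

lemma laplace_family_of_subordinator:
  assumes "subordinator_with M S \<phi> b \<nu>"
  shows "laplace_family M S \<phi>"
proof -
  have lp: "levy_process M S" and mono: "AE \<omega> in M. \<forall>s t. 0 \<le> s \<and> s \<le> t \<longrightarrow> S s \<omega> \<le> S t \<omega>"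
    and b: "bernstein_function \<phi>" and l: "laplace_exponent M S \<phi>"
    using assms by (auto simp: subordinator_with_def subordinator_def)
  have M: "prob_space M" and rv: "\<And>t. t \<ge> 0 \<Longrightarrow> S t \<in> borel_measurable M"
    and S0: "AE \<omega> in M. S 0 \<omega> = 0"
    using lp by (auto simp: levy_process_def)
  interpret prob_space M by fact
  show ?thesis
  proof unfold_locales
    fix t :: real assume t: "t \<ge> 0"
    show "S t \<in> borel_measurable M" using rv t .
    show "AE \<omega> in M. 0 \<le> S t \<omega>"
      using mono S0 by eventually_elim (use t in force)
    show "expectation (\<lambda>\<omega>. exp (- u * S t \<omega>)) = exp (- t * \<phi> u)" if "u > 0" for u
      using l t that by (simp add: laplace_exponent_def)
  qed fact
qed

text \<open>In the first and third blocks \<open>C\<close> is chosen before the process, which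
  expresses that it depends on the listed parameters alone; in the second block it may depend on the
  process.\<close>

theorem theorem2p1:
  shows
   "(\<forall>\<theta>>0. \<forall>\<delta>\<in>{0<..1}. \<forall>c>0. \<forall>\<alpha>\<in>{0<..<1}. \<exists>C>0.
      \<forall>(M::'a measure) S \<phi> b \<nu>.
        subordinator_with M S \<phi> b \<nu> \<and> dominates \<nu> (stable_measure c \<alpha>) \<longrightarrow>
        (\<forall>\<^sub>F t in at_top.
           prob_space.expectation M (\<lambda>\<omega>. exp (- \<theta> * (S t \<omega> powr \<delta>)))
             \<le> exp (- C * t powr (\<delta> / (\<alpha> * (1 - \<delta>) + \<delta>)))))
  \<and>
    (\<forall>(M::'a measure) S \<phi> b \<nu>. subordinator_with M S \<phi> b \<nu> \<longrightarrow>
      (\<forall>\<beta>>0.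
        (\<forall>t>0. neg_moment M (S t) \<beta>
            \<ge> ennreal (1 / (exp 1 * \<beta> * Gamma \<beta>)) * ennreal_powr (bernstein_inv \<phi> (1 / t)) \<beta>)
        \<and>
        (Liminf at_top (\<lambda>s. ereal (\<phi> s / ln s)) > 0 \<and>
         (\<exists>r>1. Liminf (at_right 0) (\<lambda>s. ereal (\<phi> (r * s) / \<phi> s)) > 1) \<longrightarrow>
         (\<exists>C>0. \<forall>\<^sub>F t in at_top.
            neg_moment M (S t) \<beta> \<le> ennreal C * ennreal_powr (bernstein_inv \<phi> (1 / t)) \<beta>))
        \<and>
        ((\<exists>r>1. Liminf at_top (\<lambda>s. ereal (\<phi> (r * s) / \<phi> s)) > 1) \<longrightarrow>
         (\<exists>C>0. \<forall>t\<in>{0<..1}.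
            neg_moment M (S t) \<beta> \<le> ennreal C * ennreal_powr (bernstein_inv \<phi> (1 / t)) \<beta>)))
      \<and>
      ((\<exists>r>1. Liminf (at_right 0) (\<lambda>s. ereal (\<phi> (r * s) / \<phi> s)) > 1) \<longrightarrow>
       (\<forall>r>1. Liminf (at_right 0) (\<lambda>s. ereal (\<phi> (r * s) / \<phi> s)) > 1))
      \<and>
      ((\<exists>r>1. Liminf at_top (\<lambda>s. ereal (\<phi> (r * s) / \<phi> s)) > 1) \<longrightarrow>
       (\<forall>r>1. Liminf at_top (\<lambda>s. ereal (\<phi> (r * s) / \<phi> s)) > 1)))
  \<and>
    (\<forall>\<gamma>>0. \<forall>c>0. \<forall>\<alpha>\<in>{0<..<1}.
      (\<exists>C>0. \<forall>(M::'a measure) S \<phi> b \<nu>.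
        subordinator_with M S \<phi> b \<nu> \<and> dominates \<nu> (stable_measure c \<alpha>) \<longrightarrow>
        (\<forall>t>0. neg_log_moment M (S t) \<gamma> \<le> ennreal (C * ln (1 + t powr (1 / \<alpha>)) powr (- \<gamma>))))
      \<and>
      (\<exists>C>0. \<forall>(M::'a measure) S \<phi> b \<nu>.
        subordinator_with M S \<phi> b \<nu> \<and> b = 0 \<and> \<nu> = stable_measure c \<alpha> \<longrightarrow>
        (\<forall>t>0. neg_log_moment M (S t) \<gamma> \<ge> ennreal (C * ln (1 + t powr (1 / \<alpha>)) powr (- \<gamma>)))))"
    (is "?A \<and> ?B \<and> ?C")
proof (intro conjI)
  \<comment> \<open>The constant of \<open>levy_khintchine_ge_powr\<close>, a function of
    \<open>c\<close> and \<open>\<alpha>\<close> only.\<close>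
  let ?a = "\<lambda>c \<alpha>::real. (1 - exp (- 1)) * (c * 2 powr (- 1 - \<alpha>))"
  have a_pos: "?a c \<alpha> > 0" if "c > 0" for c \<alpha> using that by simp
  have lower: "?a c \<alpha> * u powr \<alpha> \<le> \<phi> u"
    if "subordinator_with M S \<phi> b \<nu>" "dominates \<nu> (stable_measure c \<alpha>)" "c > 0" "\<alpha> > 0" "u > 0"
    for M :: "'a measure" and S \<phi> b \<nu> c \<alpha> u
    using that by (intro levy_khintchine_ge_powr) (auto simp: subordinator_with_def)
  show ?A
  proof (intro allI ballI impI)
    fix \<theta> \<delta> c \<alpha> :: real
    assume \<theta>: "\<theta> > 0" and \<delta>: "\<delta> \<in> {0<..1}" and c: "c > 0" and \<alpha>: "\<alpha> \<in> {0<..<1}"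
    define m where "m = min (?a c \<alpha> * \<theta> powr \<alpha>) \<theta>"
    define p where "p = \<delta> / (\<alpha> * (1 - \<delta>) + \<delta>)"
    have m: "m > 0" using a_pos[OF c, of \<alpha>] \<theta> by (simp add: m_def)
    have p: "p > 0" using \<delta> \<alpha> by (simp add: p_def add_nonneg_pos)
    \<comment> \<open>From this threshold on, the factor 2 is absorbed by halving the rate
      \<open>m\<close>.\<close>
    have "\<forall>\<^sub>F t in at_top. 2 * ln 2 / m \<le> t powr p"
      using eventually_ge_at_top[of "(2 * ln 2 / m) powr (1 / p)"]
    proof eventually_elim
      case (elim t)
      have "2 * ln 2 / m = ((2 * ln 2 / m) powr (1 / p)) powr p"
        using m p by (simp add: powr_powr)
      also have "\<dots> \<le> t powr p" using elim p by (intro powr_mono2) auto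
      finally show ?case .
    qed
    hence ev: "\<forall>\<^sub>F t in at_top. 2 * exp (- m * t powr p) \<le> exp (- (m / 2) * t powr p)"
    proof eventually_elim
      fix t :: real assume "2 * ln 2 / m \<le> t powr p"
      hence "ln 2 + - m * t powr p \<le> - (m / 2) * t powr p" using m by (simp add: field_simps)
      hence "exp (ln 2 + - m * t powr p) \<le> exp (- (m / 2) * t powr p)" by (simp only: exp_le_cancel_iff)
      thus "2 * exp (- m * t powr p) \<le> exp (- (m / 2) * t powr p)" unfolding exp_add by simp
    qed
    have "\<forall>\<^sub>F t in at_top. prob_space.expectation M (\<lambda>\<omega>. exp (- \<theta> * (S t \<omega> powr \<delta>)))
             \<le> exp (- (m / 2) * t powr p)"
      if "subordinator_with M S \<phi> b \<nu> \<and> dominates \<nu> (stable_measure c \<alpha>)"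
      for M :: "'a measure" and S \<phi> b \<nu>
    proof -
      interpret laplace_family M S \<phi> using that laplace_family_of_subordinator by blast
      have low: "?a c \<alpha> * u powr \<alpha> \<le> \<phi> u" if "u > 0" for u
        using lower \<open>subordinator_with M S \<phi> b \<nu> \<and> _\<close> c \<alpha> that by auto
      show ?thesis
        using ev eventually_gt_at_top[of 0]
      proof eventually_elim
        case (elim t)
        have "expectation (\<lambda>\<omega>. exp (- \<theta> * (S t \<omega> powr \<delta>))) \<le> 2 * exp (- m * t powr p)"
          unfolding m_def p_def using \<alpha> \<theta> \<delta> elim low by (intro expectation_exp_powr_le) auto
        thus ?case using elim by linarith
      qed
    qed
    thus "\<exists>C>0. \<forall>(M::'a measure) S \<phi> b \<nu>.
        subordinator_with M S \<phi> b \<nu> \<and> dominates \<nu> (stable_measure c \<alpha>) \<longrightarrow>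
        (\<forall>\<^sub>F t in at_top.
           prob_space.expectation M (\<lambda>\<omega>. exp (- \<theta> * (S t \<omega> powr \<delta>)))
             \<le> exp (- C * t powr (\<delta> / (\<alpha> * (1 - \<delta>) + \<delta>))))"
      using m unfolding p_def by (intro exI[of _ "m / 2"]) auto
  qed
  show ?B
  proof (intro allI impI, goal_cases)
    case (1 M S \<phi> b \<nu>)
    interpret laplace_family M S \<phi> using 1 by (rule laplace_family_of_subordinator)
    have ev: "\<forall>\<^sub>F s in at_right 0. s > (0::real)" "\<forall>\<^sub>F s in at_top. s > (0::real)"
      by (auto simp: eventually_at_filter eventually_gt_at_top)
    show ?case
      using neg_moment_ge_bernstein_inv neg_moment_le_large_time neg_moment_le_small_time
        Liminf_ratio_transfer[OF _ _ _ ev(1)] Liminf_ratio_transfer[OF _ _ _ ev(2)]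
      by (intro conjI allI impI) (blast, blast, blast, blast, blast)
  qed
  show ?C
  proof (intro allI ballI impI conjI)
    fix \<gamma> c \<alpha> :: real
    assume \<gamma>: "\<gamma> > 0" and c: "c > 0" and \<alpha>: "\<alpha> \<in> {0<..<1}"
    \<comment> \<open>\<open>K\<close> is fixed before any process is introduced, so
      \<open>D\<close> depends on \<open>\<gamma>\<close>, \<open>c\<close> and
      \<open>\<alpha>\<close> only.\<close>
    obtain K where K: "K > 0" "\<And>v. v > 0 \<Longrightarrow> exp (- (?a c \<alpha> * v powr \<alpha>)) \<le> K * v powr - (\<gamma> + 1)"
      using exp_minus_powr_le[OF a_pos[OF c], of \<alpha> "\<gamma> + 1"] \<alpha> \<gamma> by auto
    define D where "D = 1 + (1 / \<gamma> + K) / Gamma \<gamma>"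
    have "D > 0" using \<gamma> K by (auto simp: D_def Gamma_real_pos intro!: add_pos_pos divide_pos_pos)
    moreover have "neg_log_moment M (S t) \<gamma> \<le> ennreal (D * ln (1 + t powr (1 / \<alpha>)) powr (- \<gamma>))"
      if "subordinator_with M S \<phi> b \<nu> \<and> dominates \<nu> (stable_measure c \<alpha>)" "t > 0"
      for M :: "'a measure" and S \<phi> b \<nu> t
    proof -
      interpret laplace_family M S \<phi> using that laplace_family_of_subordinator by blast
      show ?thesis
        unfolding D_def using that \<gamma> c \<alpha>
        by (intro neg_log_moment_le[OF _ K] lower[of M S \<phi> b \<nu>]) auto
    qed
    ultimately show "\<exists>C>0. \<forall>(M::'a measure) S \<phi> b \<nu>.
        subordinator_with M S \<phi> b \<nu> \<and> dominates \<nu> (stable_measure c \<alpha>) \<longrightarrow>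
        (\<forall>t>0. neg_log_moment M (S t) \<gamma> \<le> ennreal (C * ln (1 + t powr (1 / \<alpha>)) powr (- \<gamma>)))"
      by blast
  next
    fix \<gamma> c \<alpha> :: real
    assume \<gamma>: "\<gamma> > 0" and c: "c > 0" and \<alpha>: "\<alpha> \<in> {0<..<1}"
    \<comment> \<open>The value of \<open>exp (- t * \<phi> (\<gamma> / T))\<close> at
      \<open>T = t powr (1 / \<alpha>)\<close>: by homogeneity \<open>t\<close> cancels against
      \<open>T powr \<alpha>\<close>.\<close>
    define D where "D = exp (- (\<gamma> powr \<alpha> * (LINT y:{0<..}|stable_measure c \<alpha>. 1 - exp (- y))))"
    have "ennreal (D * ln (1 + t powr (1 / \<alpha>)) powr (- \<gamma>)) \<le> neg_log_moment M (S t) \<gamma>"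
      if sub: "subordinator_with M S \<phi> 0 (stable_measure c \<alpha>)" and t: "t > 0"
      for M :: "'a measure" and S \<phi> t
    proof -
      interpret laplace_family M S \<phi> using sub by (rule laplace_family_of_subordinator)
      define T where "T = t powr (1 / \<alpha>)"
      have T: "T > 0" "T powr \<alpha> = t" using t \<alpha> by (auto simp: T_def powr_powr)
      have "\<phi> (\<gamma> / T) = (\<gamma> / T) powr \<alpha> * (LINT y:{0<..}|stable_measure c \<alpha>. 1 - exp (- y))"
        using sub c \<gamma> T by (intro levy_khintchine_stable) (auto simp: subordinator_with_def)
      hence "exp (- t * \<phi> (\<gamma> / T)) = D"
        using T \<gamma> t by (simp add: D_def powr_divide)
      thus ?thesis
        using neg_log_moment_ge[OF \<gamma> T(1), of t] t by (simp add: T_def)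
    qed
    thus "\<exists>C>0. \<forall>(M::'a measure) S \<phi> b \<nu>.
        subordinator_with M S \<phi> b \<nu> \<and> b = 0 \<and> \<nu> = stable_measure c \<alpha> \<longrightarrow>
        (\<forall>t>0. neg_log_moment M (S t) \<gamma> \<ge> ennreal (C * ln (1 + t powr (1 / \<alpha>)) powr (- \<gamma>)))"
      by (intro exI[of _ D]) (auto simp: D_def)
  qed
qed

end
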